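(* Let $\mathcal{X}$ be a Higmanian scheme (in the sense defined in the context) with parameters $(f,m,n,k,t)$, $f,m,n\ge 2$. Then $\mathcal{X}$ is Q-Higmanian if and only if, for one choice of the sign $\pm$, $$t=\frac{k(f-2)}{mn}\left(mn-k\pm \sqrt{\frac{k(mn-k)}{m(n-1)}}\right).$$
   Context: An (association) scheme $\mathcal{X}$ on a finite set $\Omega$, $|\Omega|=v$, is given by a partition of $\Omega\times\Omega$ into basic relations $R_0,\dots,R_d$ ($R_0$ the diagonal), closed under inverses, with intersection numbers $p_{RS}^T$; it is symmetric if every basic relation equals its inverse. A parabolic is an equivalence relation on $\Omega$ that is a union of basic relations; $\Omega/E$ denotes its set of classes, $n_E$ the common class size; $n_R$ is the valency of a relation $R$. $\mathcal{X}$ is imprimitive if it has a parabolic other than the diagonal and $\Omega\times\Omega$, indecomposable if it is not a wreath product. A Higmanian scheme here means an imprimitive, symmetric, indecomposable scheme of rank $5$ having exactly two proper nontrivial parabolics $E\subsetneq F$. With $S,T$ the two basic relations not contained in $F$, labelled so that $n_T\le n_S$, its parameters are $f=|\Omega|/n_F$, $m=n_F/n_E$, $n=n_E$, $k=|\{\beta\in\Delta:(\alpha,\beta)\in S\}|$ for $\alpha\in\Omega$ and $\Delta\in\Omega/F$ not containing $\alpha$ (independent of choices), and $t=p_{TS}^T$. For a commutative scheme with primitive idempotents $E_0,\dots,E_d$ of its adjacency (Bose–Mesner) algebra, where $E_0=\frac1vJ$, let $m_i=\mathrm{rank}(E_i)$ and define the Krein parameters $q_{ij}^k$ by $E_i\circ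 E_j=\frac1v\sum_k q_{ij}^kE_k$ ($\circ$ the entrywise product). Let $I_0=\{0,\dots,d\}$ and let $\mathcal{I}$ be the set of $I\subseteq I_0$ such that $\langle E_i:i\in I\rangle$ is a proper nontrivial $\circ$-subalgebra of the adjacency algebra; to each such $I$ corresponds a parabolic $E(I)$, namely the one for which $\langle E_i:i\in I\rangle$ consists of the matrices of the adjacency algebra that are constant on each block $\Delta\times\Gamma$, $\Delta,\Gamma\in\Omega/E(I)$. For $I\in\mathcal{I}$ define $i\sim_I j$ iff $q_{ij}^k\ne0$ for some $k\in I$; this is an equivalence relation on $I_0$. The scheme is Q-Higmanian if there are an ordering $E_0,E_1,\dots,E_d$ of the primitive idempotents (with $E_0=\frac1vJ$) and $l\in\{1,\dots,d/2\}$ such that: (1) $I=\{0,d\}\in\mathcal{I}$; (2) the equivalence classes of $\sim_I$ are $\{i,d-i\}$ for $i\in\{0,\dots,l-1\}$ and $\{i\}$ for $i\in\{l,\dots,d-l\}$; (3) $m_{d-i}=(f'-1)m_i$ for $i\in\{0,\dots,l-1\}$, where $f'=|\Omega/E(I)|$. *)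

theory Defs
  imports "HOL-Analysis.Analysis" "HOL-Library.Disjoint_Sets"
begin

section \<open>Association schemes\<close>

definition association_scheme :: "'a set \<Rightarrow> ('a \<times> 'a) set set \<Rightarrow> bool" where
  "association_scheme \<Omega> X \<longleftrightarrow>
     finite \<Omega> \<and>
     partition_on (\<Omega> \<times> \<Omega>) X \<and>
     Id_on \<Omega> \<in> X \<and>
     (\<forall>R\<in>X. converse R \<in> X) \<and>
     (\<forall>R\<in>X. \<forall>S\<in>X. \<forall>T\<in>X. \<exists>p::nat. \<forall>(\<alpha>, \<beta>)\<in>T.
        card {\<gamma>. (\<alpha>, \<gamma>) \<in> R \<and> (\<gamma>, \<beta>) \<in> S} = p)"

text \<open>\<open>intersection_number R S T\<close> is $p_{RS}^T$.\<close>

definition intersection_number ::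
    "('a \<times> 'a) set \<Rightarrow> ('a \<times> 'a) set \<Rightarrow> ('a \<times> 'a) set \<Rightarrow> nat" where
  "intersection_number R S T =
     (THE p. \<forall>(\<alpha>, \<beta>)\<in>T. card {\<gamma>. (\<alpha>, \<gamma>) \<in> R \<and> (\<gamma>, \<beta>) \<in> S} = p)"

definition valency :: "'a set \<Rightarrow> ('a \<times> 'a) set \<Rightarrow> nat" where
  "valency \<Omega> R = (THE n. \<forall>\<alpha>\<in>\<Omega>. card (R `` {\<alpha>}) = n)"

definition symmetric_scheme :: "'a set \<Rightarrow> ('a \<times> 'a) set set \<Rightarrow> bool" where
  "symmetric_scheme \<Omega> X \<longleftrightarrow> association_scheme \<Omega> X \<and> (\<forall>R\<in>X. converse R = R)"

definition commutative_scheme :: "'a set \<Rightarrow> ('a \<times> 'a) set set \<Rightarrow> bool" where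
  "commutative_scheme \<Omega> X \<longleftrightarrow> association_scheme \<Omega> X \<and>
     (\<forall>R\<in>X. \<forall>S\<in>X. \<forall>T\<in>X. intersection_number R S T = intersection_number S R T)"

definition parabolic :: "'a set \<Rightarrow> ('a \<times> 'a) set set \<Rightarrow> ('a \<times> 'a) set \<Rightarrow> bool" where
  "parabolic \<Omega> X P \<longleftrightarrow> equiv \<Omega> P \<and> (\<exists>Y\<subseteq>X. P = \<Union>Y)"

definition proper_nontrivial_parabolic ::
    "'a set \<Rightarrow> ('a \<times> 'a) set set \<Rightarrow> ('a \<times> 'a) set \<Rightarrow> bool" where
  "proper_nontrivial_parabolic \<Omega> X P \<longleftrightarrow>
     parabolic \<Omega> X P \<and> P \<noteq> Id_on \<Omega> \<and> P \<noteq> \<Omega> \<times> \<Omega>"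

definition imprimitive :: "'a set \<Rightarrow> ('a \<times> 'a) set set \<Rightarrow> bool" where
  "imprimitive \<Omega> X \<longleftrightarrow> (\<exists>P. proper_nontrivial_parabolic \<Omega> X P)"

text \<open>The wreath product of a scheme \<open>Y\<close> on \<open>\<Delta>\<close> (the scheme inside each fibre) with a
  scheme \<open>Z\<close> on \<open>\<Gamma>\<close> (the scheme on the set of fibres).\<close>

definition wreath_product ::
    "'b set \<Rightarrow> ('b \<times> 'b) set set \<Rightarrow> 'c set \<Rightarrow> ('c \<times> 'c) set set \<Rightarrow>
     (('b \<times> 'c) \<times> ('b \<times> 'c)) set set" where
  "wreath_product \<Delta> Y \<Gamma> Z =
     (\<lambda>R. {((a, x), (b, x)) | a b x. (a, b) \<in> R \<and> x \<in> \<Gamma>}) ` Y \<union>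
     (\<lambda>S. {((a, x), (b, y)) | a b x y. a \<in> \<Delta> \<and> b \<in> \<Delta> \<and> (x, y) \<in> S}) ` (Z - {Id_on \<Gamma>})"

text \<open>Up to isomorphism, the factors may be taken on subsets of the ambient type, since their
  degrees divide \<open>card \<Omega>\<close>. Factors of degree one are excluded, because every scheme is a wreath
  product with the scheme on one point.\<close>

definition decomposable :: "'a set \<Rightarrow> ('a \<times> 'a) set set \<Rightarrow> bool" where
  "decomposable \<Omega> X \<longleftrightarrow>
     (\<exists>(\<Delta> :: 'a set) Y (\<Gamma> :: 'a set) Z \<phi>.
        association_scheme \<Delta> Y \<and> association_scheme \<Gamma> Z \<and>
        card \<Delta> \<ge> 2 \<and> card \<Gamma> \<ge> 2 \<and>
        bij_betw \<phi> (\<Delta> \<times> \<Gamma>) \<Omega> \<and>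
        X = (\<lambda>R. map_prod \<phi> \<phi> ` R) ` wreath_product \<Delta> Y \<Gamma> Z)"

section \<open>Higmanian schemes\<close>

definition higmanian :: "'a set \<Rightarrow> ('a \<times> 'a) set set \<Rightarrow> bool" where
  "higmanian \<Omega> X \<longleftrightarrow>
     symmetric_scheme \<Omega> X \<and> imprimitive \<Omega> X \<and> \<not> decomposable \<Omega> X \<and> card X = 5 \<and>
     (\<exists>E F. E \<subset> F \<and> {P. proper_nontrivial_parabolic \<Omega> X P} = {E, F})"

text \<open>If \<open>valency \<Omega> S = valency \<Omega> T\<close>, both labellings of the two basic relations outside \<open>F\<close>
  are admitted.\<close>

definition higmanian_parameters ::
    "'a set \<Rightarrow> ('a \<times> 'a) set set \<Rightarrow> nat \<Rightarrow> nat \<Rightarrow> nat \<Rightarrow> nat \<Rightarrow> nat \<Rightarrow> bool" where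
  "higmanian_parameters \<Omega> X f m n k t \<longleftrightarrow>
     (\<exists>E F S T.
        E \<subset> F \<and> {P. proper_nontrivial_parabolic \<Omega> X P} = {E, F} \<and>
        S \<noteq> T \<and> {R \<in> X. \<not> R \<subseteq> F} = {S, T} \<and> valency \<Omega> T \<le> valency \<Omega> S \<and>
        real f = real (card \<Omega>) / real (valency \<Omega> F) \<and>
        real m = real (valency \<Omega> F) / real (valency \<Omega> E) \<and>
        n = valency \<Omega> E \<and>
        k = (THE k. \<forall>\<alpha>\<in>\<Omega>. \<forall>\<Delta>\<in>\<Omega> // F. \<alpha> \<notin> \<Delta> \<longrightarrow> card {\<beta>\<in>\<Delta>. (\<alpha>, \<beta>) \<in> S} = k) \<and>
        t = intersection_number T S T)"

section \<open>The adjacency algebra\<close>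

text \<open>From here on, the point set is the whole of a finite type.\<close>

definition mat_scale :: "complex \<Rightarrow> complex^'n^'n \<Rightarrow> complex^'n^'n" where
  "mat_scale c A = (\<chi> i j. c * A $ i $ j)"

interpretation cmat: vector_space "mat_scale :: complex \<Rightarrow> complex^'n^'n \<Rightarrow> complex^'n^'n"
  by unfold_locales (simp_all add: mat_scale_def vec_eq_iff algebra_simps)

definition hadamard :: "complex^'n^'n \<Rightarrow> complex^'n^'n \<Rightarrow> complex^'n^'n" where
  "hadamard A B = (\<chi> i j. A $ i $ j * B $ i $ j)"

definition all_ones :: "complex^'n^'n" where
  "all_ones = (\<chi> i j. 1)"

definition adjacency_matrix :: "('n \<times> 'n) set \<Rightarrow> complex^'n^'n" where
  "adjacency_matrix R = (\<chi> i j. if (i, j) \<in> R then 1 else 0)"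

definition adjacency_algebra :: "('n::finite \<times> 'n) set set \<Rightarrow> (complex^'n^'n) set" where
  "adjacency_algebra X = cmat.span (adjacency_matrix ` X)"

definition primitive_idempotents :: "('n::finite \<times> 'n) set set \<Rightarrow> (complex^'n^'n) set" where
  "primitive_idempotents X =
     {P \<in> adjacency_algebra X. P \<noteq> 0 \<and> P ** P = P \<and>
        (\<forall>Q\<in>adjacency_algebra X. Q ** Q = Q \<and> P ** Q = Q \<and> Q ** P = Q \<longrightarrow> Q = 0 \<or> Q = P)}"

text \<open>\<open>idempotent_ordering X d Es\<close>: the primitive idempotents are
  \<open>Es 0, \<dots>, Es d\<close> without repetition, where \<open>d + 1\<close> is the rank of the scheme.\<close>

definition idempotent_ordering ::
    "('n::finite \<times> 'n) set set \<Rightarrow> nat \<Rightarrow> (nat \<Rightarrow> complex^'n^'n) \<Rightarrow> bool" where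
  "idempotent_ordering X d Es \<longleftrightarrow>
     card X = d + 1 \<and> bij_betw Es {..d} (primitive_idempotents X) \<and>
     Es 0 = mat_scale (1 / of_nat CARD('n)) all_ones"

text \<open>\<open>krein d Es i j k\<close> is $q_{ij}^k$; the values at \<open>k > d\<close> are set to 0 to make the
  coefficient function unique.\<close>

definition krein ::
    "nat \<Rightarrow> (nat \<Rightarrow> complex^'n::finite^'n) \<Rightarrow> nat \<Rightarrow> nat \<Rightarrow> nat \<Rightarrow> complex" where
  "krein d Es i j = (THE q. (\<forall>k>d. q k = 0) \<and>
     hadamard (Es i) (Es j) =
       mat_scale (1 / of_nat CARD('n)) (\<Sum>k\<le>d. mat_scale (q k) (Es k)))"

definition hadamard_subalgebra ::
    "('n::finite \<times> 'n) set set \<Rightarrow> (complex^'n^'n) set \<Rightarrow> bool" where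
  "hadamard_subalgebra X W \<longleftrightarrow>
     cmat.subspace W \<and> W \<subseteq> adjacency_algebra X \<and> all_ones \<in> W \<and>
     (\<forall>A\<in>W. \<forall>B\<in>W. hadamard A B \<in> W)"

text \<open>The set $\mathcal{I}$. The trivial subalgebra is the one spanned by the identity
  \<open>all_ones\<close> of the entrywise product.\<close>

definition index_sets ::
    "('n::finite \<times> 'n) set set \<Rightarrow> nat \<Rightarrow> (nat \<Rightarrow> complex^'n^'n) \<Rightarrow> nat set set" where
  "index_sets X d Es =
     {I. I \<subseteq> {..d} \<and> hadamard_subalgebra X (cmat.span (Es ` I)) \<and>
        cmat.span (Es ` I) \<noteq> cmat.span {all_ones} \<and>
        cmat.span (Es ` I) \<noteq> adjacency_algebra X}"

definition constant_on_blocks :: "('n \<times> 'n) set \<Rightarrow> complex^'n^'n \<Rightarrow> bool" where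
  "constant_on_blocks P A \<longleftrightarrow>
     (\<forall>\<Delta>\<in>UNIV // P. \<forall>\<Gamma>\<in>UNIV // P. \<forall>\<alpha>\<in>\<Delta>. \<forall>\<alpha>'\<in>\<Delta>. \<forall>\<beta>\<in>\<Gamma>. \<forall>\<beta>'\<in>\<Gamma>.
        A $ \<alpha> $ \<beta> = A $ \<alpha>' $ \<beta>')"

definition index_parabolic ::
    "('n::finite \<times> 'n) set set \<Rightarrow> (nat \<Rightarrow> complex^'n^'n) \<Rightarrow> nat set \<Rightarrow> ('n \<times> 'n) set" where
  "index_parabolic X Es I = (THE P. parabolic UNIV X P \<and>
     cmat.span (Es ` I) = {A \<in> adjacency_algebra X. constant_on_blocks P A})"

definition index_relation ::
    "nat \<Rightarrow> (nat \<Rightarrow> complex^'n::finite^'n) \<Rightarrow> nat set \<Rightarrow> (nat \<times> nat) set" where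
  "index_relation d Es I =
     {(i, j). i \<le> d \<and> j \<le> d \<and> (\<exists>k\<in>I. krein d Es i j k \<noteq> 0)}"

section \<open>Q-Higmanian schemes\<close>

definition Q_higmanian :: "('n::finite \<times> 'n) set set \<Rightarrow> bool" where
  "Q_higmanian X \<longleftrightarrow> commutative_scheme UNIV X \<and>
     (\<exists>d Es l. idempotent_ordering X d Es \<and> 1 \<le> l \<and> 2 * l \<le> d \<and>
        {0, d} \<in> index_sets X d Es \<and>
        {..d} // index_relation d Es {0, d} =
          {{i, d - i} | i. i < l} \<union> {{i} | i. l \<le> i \<and> i \<le> d - l} \<and>
        (\<forall>i<l. int (rank (Es (d - i))) =
          (int (card (UNIV // index_parabolic X Es {0, d})) - 1) * int (rank (Es i))))"

end

theory Submission
  imports Defs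
begin

text \<open>
  Let \<open>E \<subset> F\<close> be the two parabolics. If \<open>S\<close> were a union of blocks \<open>\<Delta> \<times> \<Gamma>\<close> of \<open>E\<close>-classes,
  the scheme would be a wreath product; hence \<open>A\<^sub>E A\<^sub>S\<close> is a multiple of \<open>J - A\<^sub>F\<close>, and \<open>G = A\<^sub>S - k/(mn) (J - A\<^sub>F)\<close> is
  annihilated by \<open>A\<^sub>E\<close>, \<open>A\<^sub>F\<close> and \<open>J\<close>. With \<open>N = I - A\<^sub>E/n\<close> this forces \<open>G\<^sup>2 = a N + b G\<close>, where
  \<open>a = (f - 1) w\<^sup>2\<close>, \<open>w = sqrt (k (mn - k) / (m (n - 1)))\<close>, and \<open>b\<close> is an affine function of \<open>t\<close>. If \<open>\<theta>\<close>, \<open>\<tau>\<close> are the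
  roots of \<open>x\<^sup>2 - b x - a\<close>, the primitive idempotents are \<open>J/v\<close>, \<open>A\<^sub>F/(mn) - J/v\<close>, \<open>A\<^sub>E/n - A\<^sub>F/(mn)\<close>
  and the two spectral projections of \<open>G\<close> on the image of \<open>N\<close>, whose ranks are in the ratio
  \<open>-\<tau> : \<theta>\<close>. The only two-dimensional entrywise subalgebra spanned by idempotents belongs to \<open>F\<close>, and
  apart from \<open>J/v\<close> and \<open>A\<^sub>F/(mn) - J/v\<close> it always links exactly the two projections of \<open>G\<close>. So the scheme is Q-Higmanian iff \<open>\<theta> = -(f - 1) \<tau>\<close> or
  \<open>\<tau> = -(f - 1) \<theta>\<close>; as \<open>\<theta> \<tau> = -(f - 1) w\<^sup>2\<close>, this means \<open>b = \<plusminus>(f - 2) w\<close>.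
\<close>

section \<open>Idempotent matrices and Krein parameters\<close>

lemma mat_scale_entry [simp]: "mat_scale c A $ i $ j = c * A $ i $ j"
  by (simp add: mat_scale_def)

lemma hadamard_entry [simp]: "hadamard A B $ i $ j = A $ i $ j * B $ i $ j"
  by (simp add: hadamard_def)

lemma all_ones_entry [simp]: "all_ones $ i $ j = 1"
  by (simp add: all_ones_def)

lemma adjacency_matrix_entry [simp]: "adjacency_matrix R $ i $ j = (if (i, j) \<in> R then 1 else 0)"
  by (simp add: adjacency_matrix_def)

lemma mat_scale_mult_left [simp]: "mat_scale c A ** B = mat_scale c (A ** B)"
  by (simp add: vec_eq_iff matrix_matrix_mult_def sum_distrib_left mult.assoc)

lemma mat_scale_mult_right [simp]: "A ** mat_scale c B = mat_scale c (A ** B)"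
  by (simp add: vec_eq_iff matrix_matrix_mult_def sum_distrib_left mult.left_commute)

lemma matrix_mult_add_right: "(A + B) ** C = A ** C + B ** C"
  for A B C :: "complex^'n::finite^'n"
  by (simp add: vec_eq_iff matrix_matrix_mult_def sum.distrib algebra_simps)

lemma matrix_mult_diff_right: "(A - B) ** C = A ** C - B ** C"
  for A B C :: "complex^'n::finite^'n"
  by (simp add: vec_eq_iff matrix_matrix_mult_def sum_subtractf algebra_simps)

lemma matrix_mult_diff_left: "A ** (B - C) = A ** B - A ** C"
  for A B C :: "complex^'n::finite^'n"
  by (simp add: vec_eq_iff matrix_matrix_mult_def sum_subtractf algebra_simps)

lemmas matrix_distribs =
  matrix_add_ldistrib matrix_mult_add_right matrix_mult_diff_right matrix_mult_diff_left

lemma matrix_mult_zero [simp]: "0 ** A = 0" "A ** 0 = 0"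
  for A :: "complex^'n::finite^'n"
  by (simp_all add: vec_eq_iff matrix_matrix_mult_def)

lemma matrix_mult_sum_left: "A ** (\<Sum>i\<in>I. B i) = (\<Sum>i\<in>I. A ** B i)"
  for A :: "complex^'n::finite^'n"
  by (induction I rule: infinite_finite_induct) (auto simp: matrix_add_ldistrib)

lemma matrix_mult_sum_right: "(\<Sum>i\<in>I. B i) ** A = (\<Sum>i\<in>I. B i ** A)"
  for A :: "complex^'n::finite^'n" and B :: "'i \<Rightarrow> complex^'n^'n"
  by (induction I rule: infinite_finite_induct) (auto simp: matrix_mult_add_right)

lemma trace_mat_scale: "trace (mat_scale c A) = c * trace A"
  by (simp add: trace_def sum_distrib_left)

text \<open>Expand the rows of \<open>P\<close> in a basis \<open>B\<close> of the row space, so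
  that \<open>P\<close> is a sum of column-times-row products, one for each b in \<open>B\<close>.
  Idempotence makes the columns dual to the basis rows, so each b contributes 1 to the trace, and
  the number of them is the rank.\<close>

lemma rank_idempotent_eq_trace:
  fixes P :: "complex^'n::finite^'n"
  assumes P: "P ** P = P"
  shows "of_nat (rank P) = trace P"
proof -
  obtain B where B: "B \<subseteq> rows P" "vec.independent B" "rows P \<subseteq> vec.span B" "card B = vec.dim (rows P)"
    using vec.basis_exists[of "rows P"] by blast
  have finB: "finite B"
    using B(2) vec.finiteI_independent by blast
  define c where "c = (\<lambda>i. vec.representation B (row i P))"
  have row_in: "row i P \<in> vec.span B" for i
    using B(3) by (auto simp: rows_def)
  have row: "row i P = (\<Sum>b\<in>B. c i b *s b)" for i
    unfolding c_def by (rule vec.sum_representation_eq[symmetric]) (use B finB row_in in auto)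
  have entry: "P $ i $ j = (\<Sum>b\<in>B. c i b * b $ j)" for i j
    using arg_cong[OF row, of "\<lambda>x. x $ j" i] by (simp add: row_def)
  \<comment> \<open>Each b is a row of \<open>P\<close>, so idempotence says that right
    multiplication by \<open>P\<close> fixes b.\<close>
  have fixed: "(\<Sum>i\<in>UNIV. b $ i * P $ i $ j) = b $ j" if "b \<in> B" for b j
  proof -
    obtain r where "b = row r P"
      using B(1) \<open>b \<in> B\<close> by (auto simp: rows_def)
    then show ?thesis
      using arg_cong[OF P, of "\<lambda>Q. Q $ r $ j"] by (simp add: row_def matrix_matrix_mult_def)
  qed
  \<comment> \<open>Expanding the fixed vector b again in the basis \<open>B\<close> and comparing
    the coefficients of b gives the diagonal case of the duality.\<close>
  have one: "(\<Sum>i\<in>UNIV. b $ i * c i b) = 1" if b: "b \<in> B" for b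
  proof -
    have "(\<Sum>b'\<in>B. ((\<Sum>i\<in>UNIV. b $ i * c i b') - (if b' = b then 1 else 0)) *s b') = 0"
    proof (subst vec_eq_iff, rule allI)
      fix j
      have "(\<Sum>b'\<in>B. (\<Sum>i\<in>UNIV. b $ i * c i b') * b' $ j) = (\<Sum>i\<in>UNIV. b $ i * P $ i $ j)"
        unfolding entry sum_distrib_left sum_distrib_right
        by (subst sum.swap) (simp add: mult.assoc)
      also have "\<dots> = b $ j"
        by (rule fixed[OF b])
      finally have "(\<Sum>b'\<in>B. (\<Sum>i\<in>UNIV. b $ i * c i b') * b' $ j) = b $ j" .
      moreover have "(\<Sum>b'\<in>B. (if b' = b then 1 else 0) * b' $ j) = b $ j"
        using finB b by (simp add: if_distrib[of "\<lambda>x. x * _"] cong: if_cong)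
      ultimately show "(\<Sum>b'\<in>B. ((\<Sum>i\<in>UNIV. b $ i * c i b') - (if b' = b then 1 else 0)) *s b') $ j
          = (0 :: complex^'n) $ j"
        by (simp add: left_diff_distrib sum_subtractf)
    qed
    from vec.independentD[OF B(2) finB subset_refl this b] show ?thesis
      by simp
  qed
  have "trace P = (\<Sum>b\<in>B. \<Sum>i\<in>UNIV. b $ i * c i b)"
    unfolding trace_def entry by (subst sum.swap) (simp add: mult.commute)
  also have "\<dots> = of_nat (card B)"
    using one by simp
  finally show ?thesis
    using B(4) by (simp add: row_rank_def_gen)
qed

section \<open>Systems of orthogonal idempotents\<close>

locale orthogonal_idempotents =
  fixes Es :: "nat \<Rightarrow> complex^'n::finite^'n" and d :: nat
  assumes nonzero: "i \<le> d \<Longrightarrow> Es i \<noteq> 0"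
    and mult: "i \<le> d \<Longrightarrow> j \<le> d \<Longrightarrow> Es i ** Es j = (if i = j then Es i else 0)"
begin

lemma inj_on_Es: "inj_on Es {..d}"
  by (rule inj_onI) (metis atMost_iff mult nonzero)

text \<open>Multiplying by \<open>Es i\<close> reads off the i-th coordinate; uniqueness of
  coordinates, primitivity and the evaluation of Krein parameters all rest on this.\<close>

lemma mult_sum:
  assumes "i \<le> d"
  shows "Es i ** (\<Sum>j\<le>d. mat_scale (c j) (Es j)) = mat_scale (c i) (Es i)"
proof -
  have "Es i ** (\<Sum>j\<le>d. mat_scale (c j) (Es j)) = (\<Sum>j\<le>d. if i = j then mat_scale (c j) (Es j) else 0)"
    unfolding matrix_mult_sum_left using assms by (intro sum.cong) (auto simp: mult)
  then show ?thesis
    using assms by simp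
qed

lemma span_coordinates:
  assumes "A \<in> cmat.span (Es ` {..d})"
  obtains c where "A = (\<Sum>j\<le>d. mat_scale (c j) (Es j))"
proof -
  obtain u where "A = (\<Sum>v\<in>Es ` {..d}. mat_scale (u v) v)"
    using assms by (subst (asm) cmat.span_finite) auto
  then have "A = (\<Sum>j\<le>d. mat_scale (u (Es j)) (Es j))"
    by (simp add: sum.reindex[OF inj_on_Es])
  then show ?thesis
    by (rule that)
qed

lemma coordinate_unique:
  assumes "(\<Sum>j\<le>d. mat_scale (c j) (Es j)) = (\<Sum>j\<le>d. mat_scale (c' j) (Es j))" "i \<le> d"
  shows "c i = c' i"
  using arg_cong[OF assms(1), of "\<lambda>A. Es i ** A"] assms(2) nonzero
  by (simp add: mult_sum)

text \<open>A nonzero coordinate of an idempotent equals 1. So a primitive \<open>P\<close> has some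
  \<open>Es i\<close> below it, and minimality identifies the two. Conversely, whatever lies below
  \<open>Es i\<close> is a multiple of it, with factor 0 or 1.\<close>

lemma primitive_idempotents_eq:
  assumes X: "adjacency_algebra X = cmat.span (Es ` {..d})"
  shows "primitive_idempotents X = Es ` {..d}"
proof (intro equalityI subsetI)
  fix P assume P: "P \<in> primitive_idempotents X"
  then have PX: "P \<in> cmat.span (Es ` {..d})" and P0: "P \<noteq> 0" and PP: "P ** P = P"
    and min: "\<And>Q. Q \<in> cmat.span (Es ` {..d}) \<Longrightarrow> Q ** Q = Q \<Longrightarrow> P ** Q = Q \<Longrightarrow> Q ** P = Q
      \<Longrightarrow> Q = 0 \<or> Q = P"
    unfolding primitive_idempotents_def X by auto
  obtain c where c: "P = (\<Sum>j\<le>d. mat_scale (c j) (Es j))"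
    using span_coordinates[OF PX] .
  have EP: "Es i ** P = mat_scale (c i) (Es i)" if "i \<le> d" for i
    unfolding c using mult_sum that by blast
  have PE: "P ** Es i = mat_scale (c i) (Es i)" if "i \<le> d" for i
  proof -
    have "P ** Es i = (\<Sum>j\<le>d. if j = i then mat_scale (c j) (Es j) else 0)"
      unfolding c matrix_mult_sum_right using that by (intro sum.cong) (auto simp: mult)
    then show ?thesis
      using that by simp
  qed
  obtain i where i: "i \<le> d" "c i \<noteq> 0"
    using P0 c by (metis (no_types, lifting) atMost_iff cmat.scale_eq_0_iff sum.neutral)
  have "mat_scale (c i) (Es i) = mat_scale (c i * c i) (Es i)"
    using EP[OF i(1)] arg_cong[OF PP, of "\<lambda>A. Es i ** A"]
    by (simp add: matrix_mul_assoc)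
  then have "c i = 1"
    using i nonzero by simp
  then have "Es i = 0 \<or> Es i = P"
    using min[of "Es i"] EP[OF i(1)] PE[OF i(1)] i(1) mult[of i i]
    by (simp add: cmat.span_base)
  then show "P \<in> Es ` {..d}"
    using nonzero i(1) by auto
next
  fix P assume "P \<in> Es ` {..d}"
  then obtain i where i: "i \<le> d" "P = Es i"
    by auto
  have "Q = 0 \<or> Q = P" if Q: "Q \<in> cmat.span (Es ` {..d})" "Q ** Q = Q" "P ** Q = Q" for Q
  proof -
    obtain c where "Q = (\<Sum>j\<le>d. mat_scale (c j) (Es j))"
      using span_coordinates[OF Q(1)] .
    then have Qi: "Q = mat_scale (c i) (Es i)"
      using mult_sum[OF i(1)] Q(3) i(2) by metis
    then have "mat_scale (c i * c i) (Es i) = mat_scale (c i) (Es i)"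
      using Q(2) i mult[of i i] by simp
    then have "c i = 0 \<or> c i = 1"
      using nonzero[OF i(1)] by simp
    then show ?thesis
      using Qi i by auto
  qed
  then show "P \<in> primitive_idempotents X"
    using i nonzero mult[of i i] unfolding primitive_idempotents_def X
    by (auto intro: cmat.span_base)
qed

text \<open>Up to the positive degree, the Krein parameter is the k-th coordinate of the entrywise
  product, and multiplication by \<open>Es k\<close> extracts exactly that coordinate. Most of the
  proof shows that the definite description in \<open>krein\<close> is well defined.\<close>

lemma krein_nonzero_iff:
  assumes H: "hadamard (Es i) (Es j) \<in> cmat.span (Es ` {..d})" and k: "k \<le> d"
  shows "krein d Es i j k \<noteq> 0 \<longleftrightarrow> Es k ** hadamard (Es i) (Es j) \<noteq> 0"
proof -
  let ?H = "hadamard (Es i) (Es j)"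
  obtain c where c: "?H = (\<Sum>j\<le>d. mat_scale (c j) (Es j))"
    using span_coordinates[OF H] .
  \<comment> \<open>The coordinates rescaled by the degree and set to 0 beyond \<open>d\<close>, as
    \<open>krein\<close> demands.\<close>
  define q where "q = (\<lambda>k. if k \<le> d then of_nat CARD('n) * c k else 0)"
  let ?p = "\<lambda>q. (\<forall>k>d. q k = 0) \<and>
     ?H = mat_scale (1 / of_nat CARD('n)) (\<Sum>k\<le>d. mat_scale (q k) (Es k))"
  have rew: "mat_scale (1 / of_nat CARD('n)) (\<Sum>k\<le>d. mat_scale (q k) (Es k)) =
      (\<Sum>k\<le>d. mat_scale (q k / of_nat CARD('n)) (Es k))" for q
    by (simp add: cmat.scale_sum_right)
  have "?p q"
    unfolding rew c q_def by (auto intro!: sum.cong)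
  moreover have "q' = q" if "?p q'" for q'
  proof
    fix k
    show "q' k = q k"
    proof (cases "k \<le> d")
      case True
      from that \<open>?p q\<close> have "q' k / of_nat CARD('n) = q k / of_nat CARD('n)"
        unfolding rew by (metis coordinate_unique[OF _ True])
      then show ?thesis
        by simp
    qed (use that q_def in auto)
  qed
  ultimately have "krein d Es i j = q"
    unfolding krein_def by (rule the_equality)
  moreover have "Es k ** ?H = mat_scale (c k) (Es k)"
    unfolding c by (rule mult_sum[OF k])
  ultimately show ?thesis
    using k nonzero by (simp add: q_def)
qed

end

section \<open>The adjacency algebra\<close>

text \<open>The adjacency matrices are the indicators of the parts of a partition, so a combination
  of them has one value on each part, and these values can be prescribed freely. Membership thereby
  becomes a test on entries.\<close>

lemma adjacency_algebra_iff:
  fixes X :: "('n::finite \<times> 'n) set set"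
  assumes X: "partition_on UNIV X"
  shows "A \<in> adjacency_algebra X \<longleftrightarrow>
    (\<forall>R\<in>X. \<forall>\<alpha> \<beta> \<gamma> \<delta>. (\<alpha>, \<beta>) \<in> R \<longrightarrow> (\<gamma>, \<delta>) \<in> R \<longrightarrow> A $ \<alpha> $ \<beta> = A $ \<gamma> $ \<delta>)"
proof
  assume "A \<in> adjacency_algebra X"
  then show "\<forall>R\<in>X. \<forall>\<alpha> \<beta> \<gamma> \<delta>. (\<alpha>, \<beta>) \<in> R \<longrightarrow> (\<gamma>, \<delta>) \<in> R \<longrightarrow> A $ \<alpha> $ \<beta> = A $ \<gamma> $ \<delta>"
    unfolding adjacency_algebra_def
  proof (induction rule: cmat.span_induct_alt)
    case base
    show ?case by simp
  next
    case (step c B A)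
    then obtain Q where Q: "Q \<in> X" "B = adjacency_matrix Q" by auto
    show ?case
    proof (intro ballI allI impI)
      fix R \<alpha> \<beta> \<gamma> \<delta> assume R: "R \<in> X" "(\<alpha>, \<beta>) \<in> R" "(\<gamma>, \<delta>) \<in> R"
      have "(\<alpha>, \<beta>) \<in> Q \<longleftrightarrow> (\<gamma>, \<delta>) \<in> Q"
        using partition_onD2[OF X] R Q(1) by (auto simp: disjoint_def)
      moreover have "A $ \<alpha> $ \<beta> = A $ \<gamma> $ \<delta>"
        using step.IH R by blast
      ultimately show "(mat_scale c B + A) $ \<alpha> $ \<beta> = (mat_scale c B + A) $ \<gamma> $ \<delta>"
        using Q(2) by simp
    qed
  qed
next
  assume const: "\<forall>R\<in>X. \<forall>\<alpha> \<beta> \<gamma> \<delta>. (\<alpha>, \<beta>) \<in> R \<longrightarrow> (\<gamma>, \<delta>) \<in> R \<longrightarrow> A $ \<alpha> $ \<beta> = A $ \<gamma> $ \<delta>"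
  \<comment> \<open>The coefficient of R is the entry of \<open>A\<close> at an arbitrarily chosen
    pair of R.\<close>
  define a where "a = (\<lambda>R. let p = SOME p. p \<in> R in A $ fst p $ snd p)"
  have "A = (\<Sum>R\<in>X. mat_scale (a R) (adjacency_matrix R))"
  proof (simp only: vec_eq_iff, intro allI)
    fix \<alpha> \<beta>
    obtain R where R: "R \<in> X" "(\<alpha>, \<beta>) \<in> R"
      using partition_onD1[OF X] by (metis UNIV_I UnionE)
    have "(fst (SOME p. p \<in> R), snd (SOME p. p \<in> R)) \<in> R"
      using R(2) by (metis prod.collapse someI)
    then have aR: "a R = A $ \<alpha> $ \<beta>"
      using const R unfolding a_def Let_def by blast
    have "(\<Sum>Q\<in>X. mat_scale (a Q) (adjacency_matrix Q)) $ \<alpha> $ \<beta> =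
        (\<Sum>Q\<in>X. if Q = R then a Q else 0)"
      unfolding sum_component using R partition_onD2[OF X]
      by (intro sum.cong) (auto simp: disjoint_def)
    then show "A $ \<alpha> $ \<beta> = (\<Sum>R\<in>X. mat_scale (a R) (adjacency_matrix R)) $ \<alpha> $ \<beta>"
      using R aR by simp
  qed
  moreover have "(\<Sum>R\<in>X. mat_scale (a R) (adjacency_matrix R)) \<in> adjacency_algebra X"
    unfolding adjacency_algebra_def by (intro cmat.span_sum cmat.span_scale cmat.span_base) auto
  ultimately show "A \<in> adjacency_algebra X" by simp
qed

lemma adjacency_matrix_mult_entry:
  "(adjacency_matrix R ** adjacency_matrix S) $ \<alpha> $ \<beta> =
    of_nat (card {\<gamma> :: 'n::finite. (\<alpha>, \<gamma>) \<in> R \<and> (\<gamma>, \<beta>) \<in> S})"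
proof -
  have "(adjacency_matrix R ** adjacency_matrix S) $ \<alpha> $ \<beta> =
      (\<Sum>\<gamma>\<in>UNIV. if (\<alpha>, \<gamma>) \<in> R \<and> (\<gamma>, \<beta>) \<in> S then 1 else 0)"
    unfolding matrix_matrix_mult_def by (auto intro!: sum.cong)
  then show ?thesis
    by (simp add: sum.If_cases)
qed

lemma adjacency_mult_entry:
  "(adjacency_matrix R ** A) $ \<alpha> $ \<beta> = (\<Sum>\<gamma> | (\<alpha>, \<gamma> :: 'n::finite) \<in> R. A $ \<gamma> $ \<beta>)"
proof -
  have "(adjacency_matrix R ** A) $ \<alpha> $ \<beta> = (\<Sum>\<gamma>\<in>UNIV. if (\<alpha>, \<gamma>) \<in> R then A $ \<gamma> $ \<beta> else 0)"
    unfolding matrix_matrix_mult_def by (auto intro!: sum.cong)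
  then show ?thesis
    by (simp add: sum.If_cases)
qed

lemma constant_on_blocks_iff:
  assumes P: "equiv UNIV P"
  shows "constant_on_blocks P A \<longleftrightarrow>
    (\<forall>\<alpha> \<alpha>' \<beta> \<beta>'. (\<alpha>, \<alpha>') \<in> P \<longrightarrow> (\<beta>, \<beta>') \<in> P \<longrightarrow> A $ \<alpha> $ \<beta> = A $ \<alpha>' $ \<beta>')"
proof
  assume *: "constant_on_blocks P A"
  show "\<forall>\<alpha> \<alpha>' \<beta> \<beta>'. (\<alpha>, \<alpha>') \<in> P \<longrightarrow> (\<beta>, \<beta>') \<in> P \<longrightarrow> A $ \<alpha> $ \<beta> = A $ \<alpha>' $ \<beta>'"
  proof (intro allI impI)
    fix \<alpha> \<alpha>' \<beta> \<beta>' assume "(\<alpha>, \<alpha>') \<in> P" "(\<beta>, \<beta>') \<in> P"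
    then have "\<alpha> \<in> P `` {\<alpha>}" "\<alpha>' \<in> P `` {\<alpha>}" "\<beta> \<in> P `` {\<beta>}" "\<beta>' \<in> P `` {\<beta>}"
      using P by (auto simp: equiv_def refl_on_def)
    then show "A $ \<alpha> $ \<beta> = A $ \<alpha>' $ \<beta>'"
      using *[unfolded constant_on_blocks_def, rule_format, of "P `` {\<alpha>}" "P `` {\<beta>}" \<alpha> \<alpha>' \<beta> \<beta>']
      by (simp add: quotientI)
  qed
next
  assume *: "\<forall>\<alpha> \<alpha>' \<beta> \<beta>'. (\<alpha>, \<alpha>') \<in> P \<longrightarrow> (\<beta>, \<beta>') \<in> P \<longrightarrow> A $ \<alpha> $ \<beta> = A $ \<alpha>' $ \<beta>'"
  show "constant_on_blocks P A"
    unfolding constant_on_blocks_def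
  proof (intro ballI)
    fix \<Delta> \<Gamma> \<alpha> \<alpha>' \<beta> \<beta>'
    assume "\<Delta> \<in> UNIV // P" "\<Gamma> \<in> UNIV // P" "\<alpha> \<in> \<Delta>" "\<alpha>' \<in> \<Delta>" "\<beta> \<in> \<Gamma>" "\<beta>' \<in> \<Gamma>"
    then have "(\<alpha>, \<alpha>') \<in> P" "(\<beta>, \<beta>') \<in> P"
      using P by (meson quotient_eq_iff)+
    then show "A $ \<alpha> $ \<beta> = A $ \<alpha>' $ \<beta>'"
      using * by blast
  qed
qed

section \<open>Closure properties of the adjacency algebra\<close>

locale scheme =
  fixes X :: "('n::finite \<times> 'n) set set"
  assumes association: "association_scheme UNIV X"
begin

lemma partition: "partition_on UNIV X"
  using association by (simp add: association_scheme_def)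

lemma union_X: "\<Union>X = UNIV"
  using partition_onD1[OF partition] by simp

lemma disjoint_X: "R \<in> X \<Longrightarrow> Q \<in> X \<Longrightarrow> p \<in> R \<Longrightarrow> p \<in> Q \<Longrightarrow> R = Q"
  using partition_onD2[OF partition] by (auto simp: disjoint_def)

lemma Id_in: "Id \<in> X"
proof -
  have "Id_on (UNIV :: 'n set) = Id" by auto
  then show ?thesis
    using association by (simp add: association_scheme_def)
qed

lemma relation_nonempty: "R \<in> X \<Longrightarrow> R \<noteq> {}"
  using partition_onD3[OF partition] by auto

lemmas algebra_iff = adjacency_algebra_iff[OF partition]

lemma adjacency_in_algebra: "R \<in> X \<Longrightarrow> adjacency_matrix R \<in> adjacency_algebra X"
  unfolding adjacency_algebra_def by (rule cmat.span_base) auto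

lemma adjacency_Union_in_algebra:
  assumes "Y \<subseteq> X"
  shows "adjacency_matrix (\<Union>Y) \<in> adjacency_algebra X"
proof -
  have "(if (\<alpha>, \<beta>) \<in> \<Union>Y then 1 else 0 :: complex) = (if (\<gamma>, \<delta>) \<in> \<Union>Y then 1 else 0)" if "R \<in> X" "(\<alpha>, \<beta>) \<in> R" "(\<gamma>, \<delta>) \<in> R" for R \<alpha> \<beta> \<gamma> \<delta>
  proof -
    have "(\<alpha>, \<beta>) \<in> \<Union>Y \<longleftrightarrow> (\<gamma>, \<delta>) \<in> \<Union>Y"
      using disjoint_X that assms by blast
    then show ?thesis by simp
  qed
  then show ?thesis
    unfolding algebra_iff adjacency_matrix_entry by blast
qed

lemma all_ones_in_algebra: "all_ones \<in> adjacency_algebra X"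
  unfolding algebra_iff by simp

lemma subspace_algebra: "cmat.subspace (adjacency_algebra X)"
  unfolding adjacency_algebra_def by (rule cmat.subspace_span)

lemma algebra_constant:
  assumes "A \<in> adjacency_algebra X" "R \<in> X" "(\<alpha>, \<beta>) \<in> R" "(\<gamma>, \<delta>) \<in> R"
  shows "A $ \<alpha> $ \<beta> = A $ \<gamma> $ \<delta>"
  using assms unfolding algebra_iff by blast

lemma hadamard_in_algebra:
  assumes "A \<in> adjacency_algebra X" "B \<in> adjacency_algebra X"
  shows "hadamard A B \<in> adjacency_algebra X"
  unfolding algebra_iff hadamard_entry
proof (intro ballI allI impI)
  fix R \<alpha> \<beta> \<gamma> \<delta> assume R: "R \<in> X" "(\<alpha>, \<beta>) \<in> R" "(\<gamma>, \<delta>) \<in> R"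
  show "A $ \<alpha> $ \<beta> * B $ \<alpha> $ \<beta> = A $ \<gamma> $ \<delta> * B $ \<gamma> $ \<delta>"
    by (simp only: algebra_constant[OF assms(1) R] algebra_constant[OF assms(2) R])
qed

text \<open>For two basic relations the entries count paths, and the axioms make these counts
  constant on each basic relation; two span inductions extend this bilinearly.\<close>

lemma mult_in_algebra:
  assumes "A \<in> adjacency_algebra X" "B \<in> adjacency_algebra X"
  shows "A ** B \<in> adjacency_algebra X"
proof -
  have basic: "adjacency_matrix R ** adjacency_matrix S \<in> adjacency_algebra X" if "R \<in> X" "S \<in> X" for R S
    unfolding algebra_iff adjacency_matrix_mult_entry
  proof (intro ballI allI impI)
    fix T \<alpha> \<beta> \<gamma> \<delta> assume T: "T \<in> X" "(\<alpha>, \<beta>) \<in> T" "(\<gamma>, \<delta>) \<in> T"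
    obtain p where "\<forall>(\<alpha>, \<beta>)\<in>T. card {\<gamma>. (\<alpha>, \<gamma>) \<in> R \<and> (\<gamma>, \<beta>) \<in> S} = p"
      using association \<open>R \<in> X\<close> \<open>S \<in> X\<close> T(1) unfolding association_scheme_def by meson
    with T have "card {\<gamma>. (\<alpha>, \<gamma>) \<in> R \<and> (\<gamma>, \<beta>) \<in> S} = p" "card {\<gamma>'. (\<gamma>, \<gamma>') \<in> R \<and> (\<gamma>', \<delta>) \<in> S} = p"
      by blast+
    then show "(of_nat (card {\<gamma>. (\<alpha>, \<gamma>) \<in> R \<and> (\<gamma>, \<beta>) \<in> S}) :: complex) =
        of_nat (card {\<gamma>'. (\<gamma>, \<gamma>') \<in> R \<and> (\<gamma>', \<delta>) \<in> S})"
      by simp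
  qed
  have left: "adjacency_matrix R ** B \<in> adjacency_algebra X" if R: "R \<in> X" for R
    using assms(2)[unfolded adjacency_algebra_def]
  proof (induction rule: cmat.span_induct_alt)
    case base
    show ?case using cmat.subspace_0[OF subspace_algebra] by simp
  next
    case (step c A B)
    then show ?case
      using cmat.subspace_add[OF subspace_algebra] cmat.subspace_scale[OF subspace_algebra] basic[OF R]
      by (auto simp: matrix_add_ldistrib)
  qed
  show ?thesis
    using assms(1)[unfolded adjacency_algebra_def]
  proof (induction rule: cmat.span_induct_alt)
    case base
    show ?case using cmat.subspace_0[OF subspace_algebra] by simp
  next
    case (step c A B)
    then show ?case
      using cmat.subspace_add[OF subspace_algebra] cmat.subspace_scale[OF subspace_algebra] left
      by (auto simp: matrix_mult_add_right)
  qed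
qed

text \<open>The regularity axiom passes from basic relations to unions of them, because the counts
  are entries of a product of two members of the algebra. Parabolics are such unions.\<close>

lemma card_paths_constant:
  assumes "Y \<subseteq> X" "Z \<subseteq> X" "R \<in> X" "(\<alpha>, \<beta>) \<in> R" "(\<alpha>', \<beta>') \<in> R"
  shows "card {\<gamma>. (\<alpha>, \<gamma>) \<in> \<Union>Y \<and> (\<gamma>, \<beta>) \<in> \<Union>Z} = card {\<gamma>. (\<alpha>', \<gamma>) \<in> \<Union>Y \<and> (\<gamma>, \<beta>') \<in> \<Union>Z}"
proof -
  have "adjacency_matrix (\<Union>Y) ** adjacency_matrix (\<Union>Z) \<in> adjacency_algebra X"
    using assms(1,2) by (intro mult_in_algebra adjacency_Union_in_algebra)
  then have "(of_nat (card {\<gamma>. (\<alpha>, \<gamma>) \<in> \<Union>Y \<and> (\<gamma>, \<beta>) \<in> \<Union>Z}) :: complex) =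
      of_nat (card {\<gamma>. (\<alpha>', \<gamma>) \<in> \<Union>Y \<and> (\<gamma>, \<beta>') \<in> \<Union>Z})"
    using assms(3-5) unfolding algebra_iff adjacency_matrix_mult_entry by blast
  then show ?thesis
    by (simp only: of_nat_eq_iff)
qed

text \<open>By symmetry of \<open>P\<close>, a class is counted by the paths of length two inside it
  that return to their starting point, and these are counted over the single basic relation
  \<open>Id\<close>.\<close>

lemma card_class_constant:
  assumes "parabolic UNIV X P"
  shows "card (P `` {\<alpha>}) = valency UNIV P"
proof -
  obtain Y where Y: "Y \<subseteq> X" "P = \<Union>Y" and P: "equiv UNIV P"
    using assms by (auto simp: parabolic_def)
  have "{\<gamma>. (\<alpha>, \<gamma>) \<in> P \<and> (\<gamma>, \<alpha>) \<in> P} = P `` {\<alpha>}" for \<alpha>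
    using P by (auto simp: equiv_def sym_def)
  then have "card (P `` {\<alpha>}) = card (P `` {\<beta>})" for \<alpha> \<beta>
    using card_paths_constant[OF Y(1) Y(1) Id_in, of \<alpha> \<alpha> \<beta> \<beta>] unfolding Y(2)[symmetric] by simp
  then have "(THE n. \<forall>\<alpha>\<in>UNIV. card (P `` {\<alpha>}) = n) = card (P `` {\<alpha>})"
    by (intro the_equality ballI) (blast, metis UNIV_I)
  then show ?thesis
    by (simp add: valency_def)
qed

lemma intersection_number_eq:
  assumes "R \<in> X" "S \<in> X" "T \<in> X" "(\<alpha>, \<beta>) \<in> T"
  shows "intersection_number R S T = card {\<gamma>. (\<alpha>, \<gamma>) \<in> R \<and> (\<gamma>, \<beta>) \<in> S}"
proof -
  have const: "card {\<gamma>. (\<alpha>', \<gamma>) \<in> R \<and> (\<gamma>, \<beta>') \<in> S} = card {\<gamma>. (\<alpha>, \<gamma>) \<in> R \<and> (\<gamma>, \<beta>) \<in> S}"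
    if "(\<alpha>', \<beta>') \<in> T" for \<alpha>' \<beta>'
    using card_paths_constant[of "{R}" "{S}" T \<alpha>' \<beta>' \<alpha> \<beta>] assms that by simp
  show ?thesis
    unfolding intersection_number_def
  proof (rule the_equality)
    show "\<forall>(\<alpha>', \<beta>')\<in>T. card {\<gamma>. (\<alpha>', \<gamma>) \<in> R \<and> (\<gamma>, \<beta>') \<in> S} = card {\<gamma>. (\<alpha>, \<gamma>) \<in> R \<and> (\<gamma>, \<beta>) \<in> S}"
      using const by blast
  next
    fix p assume "\<forall>(\<alpha>, \<beta>)\<in>T. card {\<gamma>. (\<alpha>, \<gamma>) \<in> R \<and> (\<gamma>, \<beta>) \<in> S} = p"
    with assms(4) show "p = card {\<gamma>. (\<alpha>, \<gamma>) \<in> R \<and> (\<gamma>, \<beta>) \<in> S}"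
      by (auto dest: bspec)
  qed
qed

text \<open>The definite description is resolved by recovering a parabolic from its block-constant
  matrices. Two parabolics with the same block-constant matrices contain each other, since each has
  its own adjacency matrix among them.\<close>

lemma index_parabolic_eq:
  assumes P: "parabolic UNIV X P"
    and span: "cmat.span (Es ` I) = {A \<in> adjacency_algebra X. constant_on_blocks P A}"
  shows "index_parabolic X Es I = P"
proof -
  have const: "constant_on_blocks Q (adjacency_matrix Q)" if "equiv UNIV Q" for Q :: "('n \<times> 'n) set"
    unfolding constant_on_blocks_iff[OF that]
  proof (intro allI impI)
    fix \<alpha> \<alpha>' \<beta> \<beta>' assume "(\<alpha>, \<alpha>') \<in> Q" "(\<beta>, \<beta>') \<in> Q"
    then have "(\<alpha>, \<beta>) \<in> Q \<longleftrightarrow> (\<alpha>', \<beta>') \<in> Q"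
      using that by (meson equivE symE transE)
    then show "adjacency_matrix Q $ \<alpha> $ \<beta> = adjacency_matrix Q $ \<alpha>' $ \<beta>'"
      by simp
  qed
  \<comment> \<open>The positions (\<alpha>, \<alpha>) and (\<alpha>, \<beta>) lie in the same block
    of \<open>Q\<close>, and the entry at the first is 1.\<close>
  have sub: "Q \<subseteq> R" if "equiv UNIV Q" "equiv UNIV R" "constant_on_blocks Q (adjacency_matrix R)"
    for Q R :: "('n \<times> 'n) set"
  proof (rule subrelI)
    fix \<alpha> \<beta> assume "(\<alpha>, \<beta>) \<in> Q"
    moreover have "(\<alpha>, \<alpha>) \<in> Q" "(\<alpha>, \<alpha>) \<in> R"
      using that(1,2) by (auto simp: equiv_def refl_on_def)
    ultimately have "adjacency_matrix R $ \<alpha> $ \<alpha> = adjacency_matrix R $ \<alpha> $ \<beta>"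
      using that(3) unfolding constant_on_blocks_iff[OF that(1)] by blast
    then show "(\<alpha>, \<beta>) \<in> R"
      using \<open>(\<alpha>, \<alpha>) \<in> R\<close> by (simp split: if_splits)
  qed
  have alg: "adjacency_matrix Q \<in> adjacency_algebra X" if "parabolic UNIV X Q" for Q
    using that adjacency_Union_in_algebra by (auto simp: parabolic_def)
  show ?thesis
    unfolding index_parabolic_def
  proof (rule the_equality)
    fix Q assume Q: "parabolic UNIV X Q \<and> cmat.span (Es ` I) = {A \<in> adjacency_algebra X. constant_on_blocks Q A}"
    then have eq: "equiv UNIV P" "equiv UNIV Q"
      using P by (auto simp: parabolic_def)
    have "adjacency_matrix P \<in> cmat.span (Es ` I)"
      unfolding span using const eq(1) alg P by blast
    moreover have "adjacency_matrix Q \<in> cmat.span (Es ` I)"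
      using Q const eq(2) alg by blast
    ultimately have "constant_on_blocks Q (adjacency_matrix P)" "constant_on_blocks P (adjacency_matrix Q)"
      using Q span by blast+
    then show "Q = P"
      using sub eq by blast
  qed (use P span in auto)
qed

end

section \<open>Symmetric schemes\<close>

locale sym_scheme =
  fixes X :: "('n::finite \<times> 'n) set set"
  assumes symmetric: "symmetric_scheme UNIV X"
begin

sublocale scheme
  using symmetric by unfold_locales (simp add: symmetric_scheme_def)

lemma sym_relation: "R \<in> X \<Longrightarrow> (\<alpha>, \<beta>) \<in> R \<longleftrightarrow> (\<beta>, \<alpha>) \<in> R"
  using symmetric unfolding symmetric_scheme_def by (metis converse_iff)

lemma sym_algebra:
  assumes "A \<in> adjacency_algebra X"
  shows "A $ \<alpha> $ \<beta> = A $ \<beta> $ \<alpha>"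
proof -
  obtain R where R: "R \<in> X" "(\<alpha>, \<beta>) \<in> R"
    using union_X by (metis UNIV_I UnionE)
  moreover from this have "(\<beta>, \<alpha>) \<in> R"
    using sym_relation by blast
  ultimately show ?thesis
    using assms unfolding algebra_iff by blast
qed

text \<open>All members of the algebra are symmetric matrices, the product included; transposing the
  product swaps its factors.\<close>

lemma commute_algebra:
  assumes "A \<in> adjacency_algebra X" "B \<in> adjacency_algebra X"
  shows "A ** B = B ** A"
proof -
  have "(A ** B) $ \<alpha> $ \<beta> = (B ** A) $ \<alpha> $ \<beta>" for \<alpha> \<beta>
  proof -
    have "(A ** B) $ \<alpha> $ \<beta> = (A ** B) $ \<beta> $ \<alpha>"
      by (intro sym_algebra mult_in_algebra assms)
    also have "\<dots> = (B ** A) $ \<alpha> $ \<beta>"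
      unfolding matrix_matrix_mult_def
      using sym_algebra[OF assms(1)] sym_algebra[OF assms(2)] by (auto intro!: sum.cong simp: mult.commute)
    finally show ?thesis .
  qed
  then show ?thesis
    by (simp add: vec_eq_iff)
qed

lemma commutative: "commutative_scheme UNIV X"
  unfolding commutative_scheme_def
proof (intro conjI ballI)
  fix R S T assume RST: "R \<in> X" "S \<in> X" "T \<in> X"
  obtain \<alpha> \<beta> where ab: "(\<alpha>, \<beta>) \<in> T"
    using relation_nonempty[OF RST(3)] by auto
  have "intersection_number R S T = card {\<gamma>. (\<beta>, \<gamma>) \<in> R \<and> (\<gamma>, \<alpha>) \<in> S}"
    using RST ab sym_relation by (intro intersection_number_eq) auto
  also have "{\<gamma>. (\<beta>, \<gamma>) \<in> R \<and> (\<gamma>, \<alpha>) \<in> S} = {\<gamma>. (\<alpha>, \<gamma>) \<in> S \<and> (\<gamma>, \<beta>) \<in> R}"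
    using RST sym_relation by blast
  also have "card \<dots> = intersection_number S R T"
    using RST ab by (simp add: intersection_number_eq)
  finally show "intersection_number R S T = intersection_number S R T" .
qed (rule association)

end

section \<open>Wreath products and nested parabolics\<close>

lemma constant_on_relationI:
  assumes "\<And>\<alpha> \<beta> \<alpha>' \<beta>'. (\<alpha>, \<beta>) \<in> T \<Longrightarrow> (\<alpha>', \<beta>') \<in> T \<Longrightarrow> g \<alpha> \<beta> = g \<alpha>' \<beta>'"
  shows "\<exists>p. \<forall>(\<alpha>, \<beta>)\<in>T. g \<alpha> \<beta> = p"
proof (cases "T = {}")
  case False
  then obtain \<alpha> \<beta> where "(\<alpha>, \<beta>) \<in> T" by auto
  then have "\<forall>(\<alpha>', \<beta>')\<in>T. g \<alpha>' \<beta>' = g \<alpha> \<beta>"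
    using assms by blast
  then show ?thesis by blast
qed auto

context scheme
begin

lemma parabolic_Union_eq:
  assumes "parabolic UNIV X E"
  shows "\<Union>{R \<in> X. R \<subseteq> E} = E"
proof -
  obtain Y where "Y \<subseteq> X" "E = \<Union>Y"
    using assms by (auto simp: parabolic_def)
  then show ?thesis by auto
qed

lemma parabolic_relation_cases:
  assumes "parabolic UNIV X E" "R \<in> X"
  shows "R \<subseteq> E \<or> R \<inter> E = {}"
  using parabolic_Union_eq[OF assms(1)] disjoint_X[OF _ assms(2)] assms(2) by blast

text \<open>The fibre factor is one class of \<open>E\<close> with its trivial scheme, the other
  factor a set of class representatives with the traces of the remaining relations. As
  \<open>Id\<close> and \<open>E - Id\<close> are the only basic relations inside \<open>E\<close>,
  any bijections between the classes serve to identify the fibres; closure under blocks makes a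
  relation outside \<open>E\<close> depend on the representatives alone.\<close>

lemma decomposable_if_block_closed:
  assumes E: "parabolic UNIV X E" and E_Id: "E - Id \<in> X" and E_proper: "E \<noteq> UNIV"
    and closed: "\<And>R \<alpha> \<beta> \<alpha>' \<beta>'. R \<in> X \<Longrightarrow> \<not> R \<subseteq> E \<Longrightarrow> (\<alpha>, \<beta>) \<in> R \<Longrightarrow> (\<alpha>, \<alpha>') \<in> E \<Longrightarrow> (\<beta>, \<beta>') \<in> E
      \<Longrightarrow> (\<alpha>', \<beta>') \<in> R"
  shows "decomposable UNIV X"
proof -
  have eq: "equiv UNIV E" using E by (simp add: parabolic_def)
  have refl: "(x, x) \<in> E" for x using eq by (auto simp: equiv_def refl_on_def)
  have symE: "(x, y) \<in> E \<Longrightarrow> (y, x) \<in> E" for x y using eq by (meson equivE symE)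
  have transE: "(x, y) \<in> E \<Longrightarrow> (y, z) \<in> E \<Longrightarrow> (x, z) \<in> E" for x y z using eq by (meson equivE transE)
  \<comment> \<open>Both factors are taken inside the point set, as \<open>decomposable\<close>
    asks; \<open>undefined\<close> is an arbitrary base point.\<close>
  define \<Delta> where "\<Delta> = E `` {undefined}"
  define rep where "rep = (\<lambda>x. SOME y. y \<in> E `` {x})"
  define \<Gamma> where "\<Gamma> = range rep"
  have rep: "(x, rep x) \<in> E" for x
  proof -
    have "rep x \<in> E `` {x}"
      unfolding rep_def by (rule someI[of _ x]) (simp add: refl)
    then show ?thesis by simp
  qed
  have rep_eq: "rep x = rep y" if "(x, y) \<in> E" for x y
    unfolding rep_def using equiv_class_eq[OF eq that] by simp
  have \<Gamma>_eq: "x = y" if "x \<in> \<Gamma>" "y \<in> \<Gamma>" "(x, y) \<in> E" for x y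
  proof -
    obtain x' y' where "x = rep x'" "y = rep y'" using \<open>x \<in> \<Gamma>\<close> \<open>y \<in> \<Gamma>\<close> by (auto simp: \<Gamma>_def)
    then show ?thesis
      using rep_eq[of x' y'] rep[of x'] rep[of y'] that(3) transE symE by blast
  qed
  have rep_\<Gamma>: "rep x \<in> \<Gamma>" for x by (simp add: \<Gamma>_def)
  have "\<exists>h. bij_betw h \<Delta> (E `` {x})" for x
    unfolding \<Delta>_def by (rule finite_same_card_bij) (simp_all add: card_class_constant[OF E])
  then obtain h where h: "\<And>x. bij_betw (h x) \<Delta> (E `` {x})" by metis
  define \<phi> where "\<phi> = (\<lambda>(a, x). h x a)"
  have \<phi>_E: "(x, \<phi> (a, x)) \<in> E" if "a \<in> \<Delta>" for a x
    using bij_betwE[OF h[of x]] that by (auto simp: \<phi>_def)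
  have \<phi>_surj: "\<exists>a\<in>\<Delta>. \<phi> (a, x) = z" if "(x, z) \<in> E" for x z
  proof -
    have "z \<in> h x ` \<Delta>" using bij_betw_imp_surj_on[OF h[of x]] that by simp
    then show ?thesis by (auto simp: \<phi>_def)
  qed
  have \<phi>_inj: "a = b \<and> x = y" if "a \<in> \<Delta>" "b \<in> \<Delta>" "x \<in> \<Gamma>" "y \<in> \<Gamma>" "\<phi> (a, x) = \<phi> (b, y)" for a b x y
  proof -
    have "(x, \<phi> (b, y)) \<in> E" "(y, \<phi> (b, y)) \<in> E"
      using \<phi>_E[OF that(1), of x] \<phi>_E[OF that(2), of y] that(5) by simp_all
    then have "x = y" using that(3,4) \<Gamma>_eq transE symE by blast
    then show ?thesis
      using that bij_betw_imp_inj_on[OF h[of x]] by (auto simp: \<phi>_def dest: inj_onD)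
  qed
  have \<phi>: "bij_betw \<phi> (\<Delta> \<times> \<Gamma>) UNIV"
  proof (rule bij_betw_imageI)
    show "inj_on \<phi> (\<Delta> \<times> \<Gamma>)"
      using \<phi>_inj by (auto intro!: inj_onI)
    have "z \<in> \<phi> ` (\<Delta> \<times> \<Gamma>)" for z
      using \<phi>_surj[of "rep z" z] rep[of z] symE rep_\<Gamma>[of z] by force
    then show "\<phi> ` (\<Delta> \<times> \<Gamma>) = UNIV" by auto
  qed
  have \<Delta>_E: "(a, b) \<in> E" if "a \<in> \<Delta>" "b \<in> \<Delta>" for a b
    using that symE transE unfolding \<Delta>_def by blast
  have E_\<Delta>: "b \<in> \<Delta>" if "a \<in> \<Delta>" "(a, b) \<in> E" for a b
    using that transE unfolding \<Delta>_def by blast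
  define X' where "X' = {R \<in> X. \<not> R \<subseteq> E}"
  have Id_E: "Id \<subseteq> E" using refl by auto
  have X_split: "{R \<in> X. R \<subseteq> E} = {Id, E - Id}"
  proof (intro equalityI subsetI)
    fix R assume R: "R \<in> {R \<in> X. R \<subseteq> E}"
    then obtain p where "p \<in> R" using relation_nonempty by blast
    with R show "R \<in> {Id, E - Id}"
      using disjoint_X[of R Id p] disjoint_X[of R "E - Id" p] Id_in E_Id by blast
  qed (use Id_in E_Id Id_E in auto)
  have X'_E: "R \<inter> E = {}" if "R \<in> X'" for R
    using parabolic_relation_cases[OF E] that by (auto simp: X'_def)
  define Y where "Y = (\<lambda>R. R \<inter> \<Delta> \<times> \<Delta>) ` {Id, E - Id}"
  define Z where "Z = insert (Id_on \<Gamma>) ((\<lambda>R. R \<inter> \<Gamma> \<times> \<Gamma>) ` X')"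
  have Id_\<Delta>: "Id \<inter> \<Delta> \<times> \<Delta> = Id_on \<Delta>" by auto
  have undef: "undefined \<in> \<Delta>" by (simp add: \<Delta>_def refl)
  obtain u v where uv: "(u, v) \<in> E - Id" using relation_nonempty[OF E_Id] by auto
  have card_\<Delta>: "2 \<le> card \<Delta>"
  proof -
    have "card \<Delta> = card (E `` {u})"
      by (simp add: \<Delta>_def card_class_constant[OF E])
    moreover have "card {u, v} \<le> card (E `` {u})"
      using uv refl by (intro card_mono) auto
    ultimately show ?thesis using uv by auto
  qed
  obtain w where w: "w \<in> \<Delta>" "w \<noteq> undefined"
  proof (rule ccontr)
    assume "\<not> thesis"
    then have "\<Delta> \<subseteq> {undefined}" using that by blast
    then show False using card_\<Delta> card_mono[of "{undefined}" \<Delta>] by simp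
  qed
  obtain u' v' where uv': "(u', v') \<notin> E" using E_proper by auto
  have card_\<Gamma>: "2 \<le> card \<Gamma>"
  proof -
    have "rep u' \<noteq> rep v'" using uv' rep[of u'] rep[of v'] symE transE by metis
    then show ?thesis
      using card_mono[of \<Gamma> "{rep u', rep v'}"] rep_\<Gamma> by auto
  qed
  have schemeY: "association_scheme \<Delta> Y"
    unfolding association_scheme_def
  proof (intro conjI ballI)
    show "partition_on (\<Delta> \<times> \<Delta>) Y"
    proof (rule partition_onI)
      show "\<Union>Y = \<Delta> \<times> \<Delta>" using \<Delta>_E by (auto simp: Y_def)
      show "{} \<notin> Y" using w undef \<Delta>_E by (auto simp: Y_def)
    qed (auto simp: Y_def disjnt_def)
    show "Id_on \<Delta> \<in> Y" unfolding Y_def Id_\<Delta>[symmetric] by simp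
    show "R\<inverse> \<in> Y" if "R \<in> Y" for R
    proof -
      have "R\<inverse> = R" using that symE by (auto simp: Y_def)
      then show ?thesis using that by simp
    qed
    fix R S T assume RST: "R \<in> Y" "S \<in> Y" "T \<in> Y"
    then obtain R' S' T' where R': "R' \<in> {Id, E - Id}" "R = R' \<inter> \<Delta> \<times> \<Delta>"
      and S': "S' \<in> {Id, E - Id}" "S = S' \<inter> \<Delta> \<times> \<Delta>" and T': "T' \<in> {Id, E - Id}" "T = T' \<inter> \<Delta> \<times> \<Delta>"
      unfolding Y_def by blast
    have in_X: "R' \<in> X" "S' \<in> X" "T' \<in> X" "R' \<subseteq> E" using R' S' T' Id_in E_Id Id_E by auto
    show "\<exists>p. \<forall>(\<alpha>, \<beta>)\<in>T. card {\<gamma>. (\<alpha>, \<gamma>) \<in> R \<and> (\<gamma>, \<beta>) \<in> S} = p"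
    proof (rule constant_on_relationI)
      fix \<alpha> \<beta> \<alpha>' \<beta>' assume T: "(\<alpha>, \<beta>) \<in> T" "(\<alpha>', \<beta>') \<in> T"
      have "{\<gamma>. (\<alpha>, \<gamma>) \<in> R \<and> (\<gamma>, \<beta>) \<in> S} = {\<gamma>. (\<alpha>, \<gamma>) \<in> R' \<and> (\<gamma>, \<beta>) \<in> S'}" if "(\<alpha>, \<beta>) \<in> T" for \<alpha> \<beta>
        using that R'(2) S'(2) T'(2) in_X(4) E_\<Delta> by auto
      then show "card {\<gamma>. (\<alpha>, \<gamma>) \<in> R \<and> (\<gamma>, \<beta>) \<in> S} = card {\<gamma>. (\<alpha>', \<gamma>) \<in> R \<and> (\<gamma>, \<beta>') \<in> S}"
        using card_paths_constant[of "{R'}" "{S'}" T' \<alpha> \<beta> \<alpha>' \<beta>'] T in_X T'(2) by simp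
    qed
  qed simp
  have schemeZ: "association_scheme \<Gamma> Z"
    unfolding association_scheme_def
  proof (intro conjI ballI)
    show "partition_on (\<Gamma> \<times> \<Gamma>) Z"
    proof (rule partition_onI)
      have "(x, y) \<in> \<Union>Z" if "x \<in> \<Gamma>" "y \<in> \<Gamma>" for x y
      proof (cases "x = y")
        case True
        then show ?thesis using that by (auto simp: Z_def)
      next
        case False
        then have "(x, y) \<notin> E" using \<Gamma>_eq that by blast
        moreover obtain R where "R \<in> X" "(x, y) \<in> R" using union_X by (metis UNIV_I UnionE)
        ultimately show ?thesis using that unfolding Z_def X'_def by blast
      qed
      then show "\<Union>Z = \<Gamma> \<times> \<Gamma>" by (auto simp: Z_def)
      have "R \<inter> \<Gamma> \<times> \<Gamma> \<noteq> {}" if R: "R \<in> X'" for R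
      proof -
        obtain x y where "(x, y) \<in> R" using R relation_nonempty by (fastforce simp: X'_def)
        then have "(rep x, rep y) \<in> R" using closed[of R x y] R rep by (auto simp: X'_def)
        then show ?thesis using rep_\<Gamma> by blast
      qed
      moreover have "Id_on \<Gamma> \<noteq> {}" using rep_\<Gamma> by blast
      ultimately show "{} \<notin> Z" by (auto simp: Z_def)
      fix P Q assume "P \<in> Z" "Q \<in> Z" "P \<noteq> Q"
      moreover have "R \<inter> Id = {}" if "R \<in> X'" for R using X'_E[OF that] Id_E by blast
      moreover have "R = R'" if "R \<in> X'" "R' \<in> X'" "p \<in> R" "p \<in> R'" for R R' p
        using disjoint_X that by (auto simp: X'_def)
      ultimately show "disjnt P Q" unfolding Z_def disjnt_def by fast
    qed
    show "Id_on \<Gamma> \<in> Z" by (simp add: Z_def)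
    show "R\<inverse> \<in> Z" if "R \<in> Z" for R
    proof -
      have "(Q \<inter> \<Gamma> \<times> \<Gamma>)\<inverse> \<in> Z" if Q: "Q \<in> X'" for Q
      proof -
        have "Q\<inverse> \<in> X" using Q association by (auto simp: X'_def association_scheme_def)
        moreover have "\<not> Q\<inverse> \<subseteq> E" using Q symE by (auto simp: X'_def)
        moreover have "(Q \<inter> \<Gamma> \<times> \<Gamma>)\<inverse> = Q\<inverse> \<inter> \<Gamma> \<times> \<Gamma>" by auto
        ultimately show ?thesis unfolding Z_def X'_def by blast
      qed
      then show ?thesis using that by (auto simp: Z_def)
    qed
    \<comment> \<open>Each relation on \<Gamma> is the trace of a block-closed union of basic
      relations of \<open>X\<close>; the diagonal of \<Gamma> is the trace of \<open>E\<close>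
      itself.\<close>
    have lift: "\<exists>U\<subseteq>X. Q = \<Union>U \<inter> \<Gamma> \<times> \<Gamma> \<and>
        (\<forall>\<alpha> \<beta> \<alpha>' \<beta>'. (\<alpha>, \<beta>) \<in> \<Union>U \<longrightarrow> (\<alpha>, \<alpha>') \<in> E \<longrightarrow> (\<beta>, \<beta>') \<in> E \<longrightarrow> (\<alpha>', \<beta>') \<in> \<Union>U)" if Q: "Q \<in> Z" for Q
    proof (cases "Q = Id_on \<Gamma>")
      case True
      have "(\<alpha>', \<beta>') \<in> E" if "(\<alpha>, \<beta>) \<in> E" "(\<alpha>, \<alpha>') \<in> E" "(\<beta>, \<beta>') \<in> E" for \<alpha> \<beta> \<alpha>' \<beta>'
        using that symE transE by blast
      moreover have "Id_on \<Gamma> = E \<inter> \<Gamma> \<times> \<Gamma>" using \<Gamma>_eq refl by auto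
      ultimately show ?thesis
        unfolding True
        by (intro exI[of _ "{R \<in> X. R \<subseteq> E}"], unfold parabolic_Union_eq[OF E]) blast
    next
      case False
      then obtain R where R: "R \<in> X'" "Q = R \<inter> \<Gamma> \<times> \<Gamma>" using Q by (auto simp: Z_def)
      then have "R \<in> X" "\<not> R \<subseteq> E" by (auto simp: X'_def)
      then show ?thesis
        unfolding R(2) using closed[of R] by (intro exI[of _ "{R}"]) (unfold cSup_singleton, blast)
    qed
    fix R S T assume RST: "R \<in> Z" "S \<in> Z" "T \<in> Z"
    obtain U where U: "U \<subseteq> X" "R = \<Union>U \<inter> \<Gamma> \<times> \<Gamma>"
      and "\<forall>\<alpha> \<beta> \<alpha>' \<beta>'. (\<alpha>, \<beta>) \<in> \<Union>U \<longrightarrow> (\<alpha>, \<alpha>') \<in> E \<longrightarrow> (\<beta>, \<beta>') \<in> E \<longrightarrow> (\<alpha>', \<beta>') \<in> \<Union>U"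
      using lift[OF RST(1)] by blast
    note U = U this(3)[rule_format]
    obtain V where V: "V \<subseteq> X" "S = \<Union>V \<inter> \<Gamma> \<times> \<Gamma>"
      and "\<forall>\<alpha> \<beta> \<alpha>' \<beta>'. (\<alpha>, \<beta>) \<in> \<Union>V \<longrightarrow> (\<alpha>, \<alpha>') \<in> E \<longrightarrow> (\<beta>, \<beta>') \<in> E \<longrightarrow> (\<alpha>', \<beta>') \<in> \<Union>V"
      using lift[OF RST(2)] by blast
    note V = V this(3)[rule_format]
    \<comment> \<open>A path through representatives lifts to one path for each point in the class
      of its middle vertex, hence the factor \<open>card \<Delta>\<close>.\<close>
    have count: "card {\<gamma>. (\<alpha>, \<gamma>) \<in> \<Union>U \<and> (\<gamma>, \<beta>) \<in> \<Union>V} = card \<Delta> * card {\<gamma>. (\<alpha>, \<gamma>) \<in> R \<and> (\<gamma>, \<beta>) \<in> S}"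
      if "\<alpha> \<in> \<Gamma>" "\<beta> \<in> \<Gamma>" for \<alpha> \<beta>
    proof -
      have "{\<gamma>. (\<alpha>, \<gamma>) \<in> \<Union>U \<and> (\<gamma>, \<beta>) \<in> \<Union>V} = \<phi> ` (\<Delta> \<times> {\<gamma>. (\<alpha>, \<gamma>) \<in> R \<and> (\<gamma>, \<beta>) \<in> S})"
      proof (intro equalityI subsetI)
        fix \<gamma> assume "\<gamma> \<in> {\<gamma>. (\<alpha>, \<gamma>) \<in> \<Union>U \<and> (\<gamma>, \<beta>) \<in> \<Union>V}"
        then have "(\<alpha>, rep \<gamma>) \<in> \<Union>U" "(rep \<gamma>, \<beta>) \<in> \<Union>V"
          using U(3)[OF _ refl rep] V(3)[OF _ rep refl] by blast+
        then have "rep \<gamma> \<in> {\<gamma>. (\<alpha>, \<gamma>) \<in> R \<and> (\<gamma>, \<beta>) \<in> S}"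
          using that rep_\<Gamma> U(2) V(2) by blast
        moreover obtain a where "a \<in> \<Delta>" "\<phi> (a, rep \<gamma>) = \<gamma>"
          using \<phi>_surj[OF symE[OF rep]] by blast
        ultimately show "\<gamma> \<in> \<phi> ` (\<Delta> \<times> {\<gamma>. (\<alpha>, \<gamma>) \<in> R \<and> (\<gamma>, \<beta>) \<in> S})" by force
      next
        fix \<gamma> assume "\<gamma> \<in> \<phi> ` (\<Delta> \<times> {\<gamma>. (\<alpha>, \<gamma>) \<in> R \<and> (\<gamma>, \<beta>) \<in> S})"
        then obtain a x where ax: "a \<in> \<Delta>" "(\<alpha>, x) \<in> R" "(x, \<beta>) \<in> S" "\<gamma> = \<phi> (a, x)" by auto
        then show "\<gamma> \<in> {\<gamma>. (\<alpha>, \<gamma>) \<in> \<Union>U \<and> (\<gamma>, \<beta>) \<in> \<Union>V}"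
          using U(3)[OF _ refl \<phi>_E[OF ax(1)]] V(3)[OF _ \<phi>_E[OF ax(1)] refl] U(2) V(2) by blast
      qed
      moreover have "inj_on \<phi> (\<Delta> \<times> {\<gamma>. (\<alpha>, \<gamma>) \<in> R \<and> (\<gamma>, \<beta>) \<in> S})"
        by (rule inj_on_subset[OF bij_betw_imp_inj_on[OF \<phi>]]) (use U(2) in auto)
      ultimately show ?thesis
        by (simp add: card_image card_cartesian_product)
    qed
    show "\<exists>p. \<forall>(\<alpha>, \<beta>)\<in>T. card {\<gamma>. (\<alpha>, \<gamma>) \<in> R \<and> (\<gamma>, \<beta>) \<in> S} = p"
    proof (rule constant_on_relationI)
      fix \<alpha> \<beta> \<alpha>' \<beta>' assume T: "(\<alpha>, \<beta>) \<in> T" "(\<alpha>', \<beta>') \<in> T"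
      have in\<Gamma>: "\<alpha> \<in> \<Gamma>" "\<beta> \<in> \<Gamma>" "\<alpha>' \<in> \<Gamma>" "\<beta>' \<in> \<Gamma>"
        using T RST(3) by (auto simp: Z_def)
      \<comment> \<open>Both pairs of representatives lie in one basic relation of \<open>X\<close>,
        so the path counts in \<open>X\<close> agree; cancelling \<open>card \<Delta>\<close>
        transfers this to \<Gamma>.\<close>
      obtain T' where T': "T' \<in> X" "(\<alpha>, \<beta>) \<in> T'" "(\<alpha>', \<beta>') \<in> T'"
      proof (cases "T = Id_on \<Gamma>")
        case True
        then show ?thesis using that[of Id] T Id_in by auto
      next
        case False
        then obtain Q where "Q \<in> X'" "T = Q \<inter> \<Gamma> \<times> \<Gamma>" using RST(3) by (auto simp: Z_def)
        then show ?thesis using that[of Q] T by (auto simp: X'_def)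
      qed
      have "card \<Delta> * card {\<gamma>. (\<alpha>, \<gamma>) \<in> R \<and> (\<gamma>, \<beta>) \<in> S} = card \<Delta> * card {\<gamma>. (\<alpha>', \<gamma>) \<in> R \<and> (\<gamma>, \<beta>') \<in> S}"
        using card_paths_constant[OF U(1) V(1) T'] count[OF in\<Gamma>(1,2)] count[OF in\<Gamma>(3,4)] by simp
      then show "card {\<gamma>. (\<alpha>, \<gamma>) \<in> R \<and> (\<gamma>, \<beta>) \<in> S} = card {\<gamma>. (\<alpha>', \<gamma>) \<in> R \<and> (\<gamma>, \<beta>') \<in> S}"
        using card_\<Delta> by auto
    qed
  qed simp
  \<comment> \<open>Transport along \<phi> recovers the basic relations from the wreath product:
    first \<open>Id\<close>, then \<open>E - Id\<close>, then those outside
    \<open>E\<close>.\<close>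
  have wr1: "map_prod \<phi> \<phi> ` {((a, x), (b, x)) | a b x. (a, b) \<in> Id \<inter> \<Delta> \<times> \<Delta> \<and> x \<in> \<Gamma>} = Id"
  proof -
    have "(z, z) \<in> map_prod \<phi> \<phi> ` {((a, x), (b, x)) | a b x. (a, b) \<in> Id \<inter> \<Delta> \<times> \<Delta> \<and> x \<in> \<Gamma>}" for z
    proof -
      obtain a where "a \<in> \<Delta>" "\<phi> (a, rep z) = z"
        using \<phi>_surj[OF symE[OF rep]] by blast
      then show ?thesis
        using rep_\<Gamma>[of z] by (intro image_eqI[of _ _ "((a, rep z), (a, rep z))"]) auto
    qed
    then show ?thesis by auto
  qed
  have wr2: "map_prod \<phi> \<phi> ` {((a, x), (b, x)) | a b x. (a, b) \<in> (E - Id) \<inter> \<Delta> \<times> \<Delta> \<and> x \<in> \<Gamma>} = E - Id"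
  proof (intro equalityI subsetI)
    fix p assume "p \<in> map_prod \<phi> \<phi> ` {((a, x), (b, x)) | a b x. (a, b) \<in> (E - Id) \<inter> \<Delta> \<times> \<Delta> \<and> x \<in> \<Gamma>}"
    then obtain a b x where abx: "a \<in> \<Delta>" "b \<in> \<Delta>" "a \<noteq> b" "x \<in> \<Gamma>" "p = (\<phi> (a, x), \<phi> (b, x))" by auto
    then show "p \<in> E - Id"
      using \<phi>_inj[of a b x x] \<phi>_E[of a x] \<phi>_E[of b x] symE transE by blast
  next
    fix p assume p: "p \<in> E - Id"
    obtain y z where yz: "p = (y, z)" by force
    obtain a where a: "a \<in> \<Delta>" "\<phi> (a, rep y) = y" using \<phi>_surj[OF symE[OF rep]] by blast
    obtain b where b: "b \<in> \<Delta>" "\<phi> (b, rep z) = z" using \<phi>_surj[OF symE[OF rep]] by blast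
    have "rep y = rep z" using p yz rep_eq by auto
    moreover have "a \<noteq> b" using a b p yz \<open>rep y = rep z\<close> by auto
    ultimately show "p \<in> map_prod \<phi> \<phi> ` {((a, x), (b, x)) | a b x. (a, b) \<in> (E - Id) \<inter> \<Delta> \<times> \<Delta> \<and> x \<in> \<Gamma>}"
      using a b yz \<Delta>_E rep_\<Gamma>[of y] by (intro image_eqI[of _ _ "((a, rep y), (b, rep y))"]) auto
  qed
  have wr3: "map_prod \<phi> \<phi> ` {((a, x), (b, y)) | a b x y. a \<in> \<Delta> \<and> b \<in> \<Delta> \<and> (x, y) \<in> R \<inter> \<Gamma> \<times> \<Gamma>} = R"
    if R: "R \<in> X'" for R
  proof (intro equalityI subsetI)
    fix p assume "p \<in> map_prod \<phi> \<phi> ` {((a, x), (b, y)) | a b x y. a \<in> \<Delta> \<and> b \<in> \<Delta> \<and> (x, y) \<in> R \<inter> \<Gamma> \<times> \<Gamma>}"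
    then obtain a b x y where "a \<in> \<Delta>" "b \<in> \<Delta>" "(x, y) \<in> R" "p = (\<phi> (a, x), \<phi> (b, y))" by auto
    then show "p \<in> R" using closed[of R x y] R \<phi>_E by (auto simp: X'_def)
  next
    fix p assume p: "p \<in> R"
    obtain y z where yz: "p = (y, z)" by force
    obtain a where a: "a \<in> \<Delta>" "\<phi> (a, rep y) = y" using \<phi>_surj[OF symE[OF rep]] by blast
    obtain b where b: "b \<in> \<Delta>" "\<phi> (b, rep z) = z" using \<phi>_surj[OF symE[OF rep]] by blast
    have "(rep y, rep z) \<in> R" using closed[of R y z] R p yz rep by (auto simp: X'_def)
    then show "p \<in> map_prod \<phi> \<phi> ` {((a, x), (b, y)) | a b x y. a \<in> \<Delta> \<and> b \<in> \<Delta> \<and> (x, y) \<in> R \<inter> \<Gamma> \<times> \<Gamma>}"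
      using a b yz rep_\<Gamma> by (intro image_eqI[of _ _ "((a, rep y), (b, rep z))"]) auto
  qed
  have Z': "Z - {Id_on \<Gamma>} = (\<lambda>R. R \<inter> \<Gamma> \<times> \<Gamma>) ` X'"
  proof -
    have "R \<inter> \<Gamma> \<times> \<Gamma> \<noteq> Id_on \<Gamma>" if "R \<in> X'" for R
    proof -
      have "(rep undefined, rep undefined) \<in> Id_on \<Gamma>" using rep_\<Gamma> by blast
      then show ?thesis using X'_E[OF that] refl by blast
    qed
    then show ?thesis by (auto simp: Z_def)
  qed
  have wr3': "(\<lambda>R. map_prod \<phi> \<phi> ` {((a, x), (b, y)) | a b x y. a \<in> \<Delta> \<and> b \<in> \<Delta> \<and> (x, y) \<in> R \<inter> \<Gamma> \<times> \<Gamma>}) ` X' = X'"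
    using image_cong[OF HOL.refl wr3, of X' "\<lambda>R. R"] by (simp only: image_ident)
  have X_eq: "X = {Id, E - Id} \<union> X'" using X_split by (auto simp: X'_def)
  have "X = (\<lambda>R. map_prod \<phi> \<phi> ` R) ` wreath_product \<Delta> Y \<Gamma> Z"
    unfolding wreath_product_def Z' Y_def image_Un image_image image_insert image_empty wr1 wr2 wr3'
    by (rule X_eq)
  then show ?thesis
    unfolding decomposable_def using schemeY schemeZ card_\<Delta> card_\<Gamma> \<phi> by blast
qed

end

text \<open>The sum over a class has n equal summands. Together with commutativity this yields all
  products among \<open>A_E\<close>, \<open>A_F\<close> and \<open>J\<close>.\<close>

lemma block_mult:
  assumes "\<And>\<alpha> \<beta> \<gamma>. (\<alpha>, \<gamma>) \<in> P \<Longrightarrow> M $ \<gamma> $ \<beta> = M $ \<alpha> $ \<beta>" and "\<And>\<alpha>. card (P `` {\<alpha>}) = n"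
  shows "adjacency_matrix P ** M = mat_scale (of_nat n) (M :: complex^'n::finite^'n)"
proof -
  have "(\<Sum>\<gamma> | (\<alpha>, \<gamma>) \<in> P. M $ \<gamma> $ \<beta>) = of_nat n * M $ \<alpha> $ \<beta>" for \<alpha> \<beta>
  proof -
    have "(\<Sum>\<gamma> | (\<alpha>, \<gamma>) \<in> P. M $ \<gamma> $ \<beta>) = (\<Sum>\<gamma> | (\<alpha>, \<gamma>) \<in> P. M $ \<alpha> $ \<beta>)"
      using assms(1) by (intro sum.cong) auto
    also have "\<dots> = of_nat (card {\<gamma>. (\<alpha>, \<gamma>) \<in> P}) * M $ \<alpha> $ \<beta>" by simp
    also have "card {\<gamma>. (\<alpha>, \<gamma>) \<in> P} = n"
      using assms(2)[of \<alpha>] by (simp add: Image_def)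
    finally show ?thesis .
  qed
  then show ?thesis
    by (simp only: vec_eq_iff adjacency_mult_entry mat_scale_entry) blast
qed

section \<open>Nested parabolics and paths through \<open>E\<close>\<close>

locale nested_scheme = sym_scheme X for X :: "('n::finite \<times> 'n) set set" +
  fixes E F S T :: "('n \<times> 'n) set" and f m n :: nat
  assumes parabolic_E: "parabolic UNIV X E" and parabolic_F: "parabolic UNIV X F"
    and E_sub_F: "E \<subseteq> F" and F_proper: "F \<noteq> UNIV"
    and X_eq: "X = {Id, E - Id, F - E, S, T}" and outside: "S \<union> T = - F" and S_neq_T: "S \<noteq> T"
    and indecomposable: "\<not> decomposable UNIV X"
    and card_E: "card (E `` {\<alpha>}) = n" and card_F: "card (F `` {\<alpha>}) = m * n"
    and card_points: "CARD('n) = f * m * n"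
    and f_ge: "2 \<le> f" and m_ge: "2 \<le> m" and n_ge: "2 \<le> n"
begin

abbreviation "A_E \<equiv> adjacency_matrix E"
abbreviation "A_F \<equiv> adjacency_matrix F"
abbreviation "A_S \<equiv> adjacency_matrix S"
abbreviation "J \<equiv> all_ones :: complex^'n^'n"

lemma basic_in_X: "E - Id \<in> X" "F - E \<in> X" "S \<in> X" "T \<in> X"
  using X_eq by auto

lemma equiv_E: "equiv UNIV E" and equiv_F: "equiv UNIV F"
  using parabolic_E parabolic_F by (auto simp: parabolic_def)

lemma refl_E [simp]: "(x, x) \<in> E" and refl_F [simp]: "(x, x) \<in> F"
  using equiv_E equiv_F by (auto simp: equiv_def refl_on_def)

lemma sym_E: "(x, y) \<in> E \<Longrightarrow> (y, x) \<in> E" and sym_F: "(x, y) \<in> F \<Longrightarrow> (y, x) \<in> F"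
  using equiv_E equiv_F by (meson equivE symE)+

lemma trans_E: "(x, y) \<in> E \<Longrightarrow> (y, z) \<in> E \<Longrightarrow> (x, z) \<in> E"
  and trans_F: "(x, y) \<in> F \<Longrightarrow> (y, z) \<in> F \<Longrightarrow> (x, z) \<in> F"
  using equiv_E equiv_F by (meson equivE transE)+

lemma E_F: "(x, y) \<in> E \<Longrightarrow> (x, y) \<in> F"
  using E_sub_F by auto

lemma S_T_disjoint: "p \<in> S \<Longrightarrow> p \<notin> T"
  using disjoint_X basic_in_X S_neq_T by blast

lemma S_not_F: "p \<in> S \<Longrightarrow> p \<notin> F" and T_not_F: "p \<in> T \<Longrightarrow> p \<notin> F"
  using outside by blast+

lemma F_block: "(\<alpha>, \<alpha>') \<in> F \<Longrightarrow> (\<beta>, \<beta>') \<in> F \<Longrightarrow> (\<alpha>, \<beta>) \<in> F \<longleftrightarrow> (\<alpha>', \<beta>') \<in> F"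
  by (meson sym_F trans_F)

lemma E_block: "(\<alpha>, \<alpha>') \<in> E \<Longrightarrow> (\<beta>, \<beta>') \<in> E \<Longrightarrow> (\<alpha>, \<beta>) \<in> E \<longleftrightarrow> (\<alpha>', \<beta>') \<in> E"
  by (meson sym_E trans_E)

text \<open>If no block, that is no product of two classes of \<open>E\<close>, met both
  \<open>S\<close> and \<open>T\<close>, these relations would be unions of blocks, as
  \<open>F - E\<close> always is, and the scheme would be a wreath product.\<close>

lemma S_not_block_closed:
  obtains \<alpha> \<beta> \<alpha>' \<beta>' where "(\<alpha>, \<beta>) \<in> S" "(\<alpha>', \<beta>') \<in> T" "(\<alpha>, \<alpha>') \<in> E" "(\<beta>, \<beta>') \<in> E"
proof (rule ccontr)
  assume "\<not> thesis"
  then have no: "\<not> ((\<alpha>, \<beta>) \<in> S \<and> (\<alpha>', \<beta>') \<in> T \<and> (\<alpha>, \<alpha>') \<in> E \<and> (\<beta>, \<beta>') \<in> E)" for \<alpha> \<beta> \<alpha>' \<beta>'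
    using that by blast
  have "decomposable UNIV X"
  proof (rule decomposable_if_block_closed[OF parabolic_E])
    show "E \<noteq> UNIV" using E_sub_F F_proper by auto
    fix R \<alpha> \<beta> \<alpha>' \<beta>'
    assume R: "R \<in> X" "\<not> R \<subseteq> E" "(\<alpha>, \<beta>) \<in> R" "(\<alpha>, \<alpha>') \<in> E" "(\<beta>, \<beta>') \<in> E"
    have blocks: "(\<alpha>, \<beta>) \<in> E \<longleftrightarrow> (\<alpha>', \<beta>') \<in> E" "(\<alpha>, \<beta>) \<in> F \<longleftrightarrow> (\<alpha>', \<beta>') \<in> F"
      using E_block F_block E_F R by blast+
    have "Id \<subseteq> E" by auto
    then consider "R = F - E" | "R = S" | "R = T" using R X_eq by auto
    then show "(\<alpha>', \<beta>') \<in> R"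
    proof cases
      case 1
      then show ?thesis using R blocks by auto
    next
      case 2
      then show ?thesis using R blocks outside no by blast
    next
      case 3
      moreover have "\<not> ((\<alpha>', \<beta>') \<in> S \<and> (\<alpha>, \<beta>) \<in> T)" using no R sym_E by blast
      ultimately show ?thesis using R blocks outside by blast
    qed
  qed (rule basic_in_X)
  then show False using indecomposable by simp
qed

text \<open>The count depends only on the basic relation of (\<alpha>, \<beta>), so it is symmetric;
  it also depends only on the class of \<alpha>, hence by symmetry only on the classes of both
  points. A block that meets both \<open>S\<close> and \<open>T\<close> then forces the same value
  on these two relations.\<close>

lemma paths_constant:
  obtains c where "\<And>\<alpha> \<beta>. (\<alpha>, \<beta>) \<notin> F \<Longrightarrow> card {\<gamma>. (\<alpha>, \<gamma>) \<in> E \<and> (\<gamma>, \<beta>) \<in> S} = c"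
proof -
  define cnt where "cnt = (\<lambda>\<alpha> \<beta>. card {\<gamma>. (\<alpha>, \<gamma>) \<in> E \<and> (\<gamma>, \<beta>) \<in> S})"
  have const: "cnt \<alpha> \<beta> = cnt \<alpha>' \<beta>'" if "R \<in> X" "(\<alpha>, \<beta>) \<in> R" "(\<alpha>', \<beta>') \<in> R" for R \<alpha> \<beta> \<alpha>' \<beta>'
    using card_paths_constant[of "{R \<in> X. R \<subseteq> E}" "{S}" R \<alpha> \<beta> \<alpha>' \<beta>', unfolded parabolic_Union_eq[OF parabolic_E]]
      basic_in_X that unfolding cnt_def by simp
  have sym: "cnt \<alpha> \<beta> = cnt \<beta> \<alpha>" for \<alpha> \<beta>
  proof -
    obtain R where R: "R \<in> X" "(\<alpha>, \<beta>) \<in> R" using union_X by (metis UNIV_I UnionE)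
    then show ?thesis using const[OF R] sym_relation[OF R(1)] by blast
  qed
  have left: "cnt \<alpha> \<beta> = cnt \<alpha>' \<beta>" if "(\<alpha>, \<alpha>') \<in> E" for \<alpha> \<alpha>' \<beta>
  proof -
    have "{\<gamma>. (\<alpha>, \<gamma>) \<in> E \<and> (\<gamma>, \<beta>) \<in> S} = {\<gamma>. (\<alpha>', \<gamma>) \<in> E \<and> (\<gamma>, \<beta>) \<in> S}"
      using that sym_E trans_E by blast
    then show ?thesis by (simp add: cnt_def)
  qed
  obtain \<alpha> \<beta> \<alpha>' \<beta>' where ab: "(\<alpha>, \<beta>) \<in> S" "(\<alpha>', \<beta>') \<in> T" "(\<alpha>, \<alpha>') \<in> E" "(\<beta>, \<beta>') \<in> E"
    using S_not_block_closed .
  have "cnt \<alpha>' \<beta>' = cnt \<alpha> \<beta>"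
    using left[OF ab(3), of \<beta>] left[OF ab(4), of \<alpha>'] sym[of \<alpha>' \<beta>] sym[of \<alpha>' \<beta>'] by simp
  then have "cnt x y = cnt \<alpha> \<beta>" if "(x, y) \<notin> F" for x y
  proof (cases "(x, y) \<in> S")
    case True
    then show ?thesis using const[OF basic_in_X(3) True ab(1)] by simp
  next
    case False
    then have "(x, y) \<in> T" using that outside by blast
    then show ?thesis
      using const[OF basic_in_X(4) _ ab(2)] \<open>cnt \<alpha>' \<beta>' = cnt \<alpha> \<beta>\<close> by simp
  qed
  then show ?thesis using that unfolding cnt_def by blast
qed

lemma AE_in: "A_E \<in> adjacency_algebra X" and AF_in: "A_F \<in> adjacency_algebra X"
  and AS_in: "A_S \<in> adjacency_algebra X"
  using adjacency_Union_in_algebra[of "{R \<in> X. R \<subseteq> E}"] adjacency_Union_in_algebra[of "{R \<in> X. R \<subseteq> F}"]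
    parabolic_Union_eq[OF parabolic_E] parabolic_Union_eq[OF parabolic_F]
    adjacency_in_algebra basic_in_X by auto

lemma AE_AE: "A_E ** A_E = mat_scale (of_nat n) A_E"
  by (rule block_mult) (use E_block[OF _ refl_E] card_E in auto)

lemma AE_AF: "A_E ** A_F = mat_scale (of_nat n) A_F"
  by (rule block_mult) (use F_block[OF E_F refl_F] card_E in auto)

lemma AF_AF: "A_F ** A_F = mat_scale (of_nat m * of_nat n) A_F"
  using block_mult[of F A_F "m * n"] F_block[OF _ refl_F] card_F by auto

lemma AE_J: "A_E ** J = mat_scale (of_nat n) J"
  by (rule block_mult) (use card_E in auto)

lemma AF_J: "A_F ** J = mat_scale (of_nat m * of_nat n) J"
  using block_mult[of F J "m * n"] card_F by auto

lemma J_J: "J ** J = mat_scale (of_nat f * of_nat m * of_nat n) J"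
proof -
  have "J = adjacency_matrix UNIV" by (simp add: vec_eq_iff)
  moreover have "card ((UNIV :: ('n \<times> 'n) set) `` {\<alpha>}) = f * m * n" for \<alpha>
    using card_points by (simp add: Image_def)
  ultimately show ?thesis
    using block_mult[of UNIV J "f * m * n"] by auto
qed

lemma AF_AE: "A_F ** A_E = mat_scale (of_nat n) A_F"
  using commute_algebra[OF AF_in AE_in] AE_AF by simp

lemma J_AE: "J ** A_E = mat_scale (of_nat n) J"
  using commute_algebra[OF all_ones_in_algebra AE_in] AE_J by simp

lemma J_AF: "J ** A_F = mat_scale (of_nat m * of_nat n) J"
  using commute_algebra[OF all_ones_in_algebra AF_in] AF_J by simp

text \<open>The counts vanish on \<open>F\<close> and equal a constant c off it. In an
  \<open>S\<close>-pair the first point is itself a midpoint, in a \<open>T\<close>-pair it is not;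
  this puts c strictly between 0 and n.\<close>

lemma AE_AS_paths:
  obtains c where "0 < c" "c < n" "A_E ** A_S = mat_scale (of_nat c) (J - A_F)"
    "A_F ** A_S = mat_scale (of_nat c * of_nat m) (J - A_F)"
proof -
  obtain c where c: "\<And>\<alpha> \<beta>. (\<alpha>, \<beta>) \<notin> F \<Longrightarrow> card {\<gamma>. (\<alpha>, \<gamma>) \<in> E \<and> (\<gamma>, \<beta>) \<in> S} = c"
    using paths_constant by blast
  obtain \<alpha> \<beta> where S: "(\<alpha>, \<beta>) \<in> S" using relation_nonempty[OF basic_in_X(3)] by auto
  have "card {\<alpha>} \<le> card {\<gamma>. (\<alpha>, \<gamma>) \<in> E \<and> (\<gamma>, \<beta>) \<in> S}"
    using S by (intro card_mono) auto
  then have c0: "0 < c" using c[OF S_not_F[OF S]] by simp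
  obtain \<alpha> \<beta> where T: "(\<alpha>, \<beta>) \<in> T" using relation_nonempty[OF basic_in_X(4)] by auto
  have "card {\<gamma>. (\<alpha>, \<gamma>) \<in> E \<and> (\<gamma>, \<beta>) \<in> S} < card (E `` {\<alpha>})"
  proof (rule psubset_card_mono)
    have "\<alpha> \<in> E `` {\<alpha>} - {\<gamma>. (\<alpha>, \<gamma>) \<in> E \<and> (\<gamma>, \<beta>) \<in> S}"
      using T S_T_disjoint by auto
    then show "{\<gamma>. (\<alpha>, \<gamma>) \<in> E \<and> (\<gamma>, \<beta>) \<in> S} \<subset> E `` {\<alpha>}" by blast
  qed simp
  then have cn: "c < n" using c[OF T_not_F[OF T]] card_E by simp
  have "{\<gamma>. (\<alpha>, \<gamma>) \<in> E \<and> (\<gamma>, \<beta>) \<in> S} = {}" if "(\<alpha>, \<beta>) \<in> F" for \<alpha> \<beta>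
    using that outside F_block[OF E_F refl_F] by blast
  then have AES: "A_E ** A_S = mat_scale (of_nat c) (J - A_F)"
    using c by (simp add: vec_eq_iff adjacency_matrix_mult_entry)
  \<comment> \<open>The count over classes of \<open>F\<close> follows from the one over classes of
    \<open>E\<close>, because \<open>A_F ** A_E\<close> is n times \<open>A_F\<close>.\<close>
  have "mat_scale (of_nat n) (A_F ** A_S) = (A_F ** A_E) ** A_S"
    by (simp add: AF_AE)
  also have "\<dots> = mat_scale (of_nat c) (A_F ** (J - A_F))"
    unfolding matrix_mul_assoc[symmetric] AES by simp
  also have "\<dots> = mat_scale (of_nat n) (mat_scale (of_nat c * of_nat m) (J - A_F))"
    by (simp add: matrix_mult_diff_left AF_J AF_AF cmat.scale_right_diff_distrib mult_ac)
  finally have "A_F ** A_S = mat_scale (of_nat c * of_nat m) (J - A_F)"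
    using n_ge by (subst (asm) cmat.scale_left_imp_eq) auto
  then show ?thesis using that c0 cn AES by blast
qed

end

section \<open>The idempotents of a Higmanian scheme\<close>

locale higman = nested_scheme X E F S T f m n
  for X :: "('n::finite \<times> 'n) set set" and E F S T f m n +
  fixes k t :: nat
  assumes card_X: "card X = 5"
    and k_eq: "k = (THE k. \<forall>\<alpha>\<in>UNIV. \<forall>\<Delta>\<in>UNIV // F. \<alpha> \<notin> \<Delta> \<longrightarrow> card {\<beta>\<in>\<Delta>. (\<alpha>, \<beta>) \<in> S} = k)"
    and t_eq: "t = intersection_number T S T"
begin

text \<open>A class of \<open>F\<close> consists of m classes of \<open>E\<close>, and off
  \<open>F\<close> each of these contains c neighbours along \<open>S\<close>, so k = c m. This
  evaluates the definite description of \<open>k\<close> and turns the bounds on c into bounds on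
  k.\<close>

lemma k_props:
  shows k_pos: "0 < k" and k_less: "k < m * n"
    and AE_AS: "A_E ** A_S = mat_scale (of_nat k / of_nat m) (J - A_F)"
    and AF_AS: "A_F ** A_S = mat_scale (of_nat k) (J - A_F)"
proof -
  obtain c where c: "0 < c" "c < n" "A_E ** A_S = mat_scale (of_nat c) (J - A_F)"
    "A_F ** A_S = mat_scale (of_nat c * of_nat m) (J - A_F)"
    using AE_AS_paths .
  have count: "card {\<beta>\<in>\<Delta>. (\<alpha>, \<beta>) \<in> S} = c * m" if \<Delta>: "\<Delta> \<in> UNIV // F" "\<alpha> \<notin> \<Delta>" for \<alpha> \<Delta>
  proof -
    obtain \<delta> where \<delta>: "\<Delta> = F `` {\<delta>}" using \<Delta>(1) by (auto simp: quotient_def)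
    have "{\<beta>\<in>\<Delta>. (\<alpha>, \<beta>) \<in> S} = {\<gamma>. (\<delta>, \<gamma>) \<in> F \<and> (\<gamma>, \<alpha>) \<in> S}"
      using \<delta> sym_relation[OF basic_in_X(3)] by auto
    moreover have "of_nat (card {\<gamma>. (\<delta>, \<gamma>) \<in> F \<and> (\<gamma>, \<alpha>) \<in> S}) = (of_nat (c * m) :: complex)"
      using arg_cong[OF c(4), of "\<lambda>M. M $ \<delta> $ \<alpha>"] \<Delta>(2) \<delta> by (simp add: adjacency_matrix_mult_entry)
    ultimately show ?thesis by (simp only: of_nat_eq_iff)
  qed
  \<comment> \<open>A pair outside \<open>F\<close> supplies a point and a class not containing it,
    so the description of \<open>k\<close> does not hold vacuously.\<close>
  obtain \<alpha> \<delta> where "(\<delta>, \<alpha>) \<notin> F" using F_proper by auto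
  then have ex: "F `` {\<delta>} \<in> UNIV // F" "\<alpha> \<notin> F `` {\<delta>}" by (auto simp: quotientI)
  have k: "k = c * m"
    unfolding k_eq
  proof (rule the_equality)
    fix k assume "\<forall>\<alpha>\<in>UNIV. \<forall>\<Delta>\<in>UNIV // F. \<alpha> \<notin> \<Delta> \<longrightarrow> card {\<beta>\<in>\<Delta>. (\<alpha>, \<beta>) \<in> S} = k"
    then show "k = c * m" using ex count[OF ex] by blast
  qed (use count in blast)
  show "0 < k" "k < m * n" using k c(1,2) m_ge by auto
  show "A_E ** A_S = mat_scale (of_nat k / of_nat m) (J - A_F)"
    using c(3) k m_ge by simp
  show "A_F ** A_S = mat_scale (of_nat k) (J - A_F)"
    using c(4) k by simp
qed

lemma parameters_nonzero [simp]: "f \<noteq> 0" "m \<noteq> 0" "n \<noteq> 0" "k \<noteq> 0" "f \<noteq> Suc 0" "m \<noteq> Suc 0" "n \<noteq> Suc 0"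
  using f_ge m_ge n_ge k_pos by auto

text \<open>\<open>N\<close> projects onto the vectors that sum to zero on every class of
  \<open>E\<close>, and \<open>G\<close> is \<open>A_S\<close> with its mean density k/(mn) off
  \<open>F\<close> removed. The idempotents \<open>e0\<close>, \<open>eF\<close>, \<open>eE\<close>
  are the successive differences of the averaging projections for the whole set, \<open>F\<close>
  and \<open>E\<close>.\<close>

definition "N = mat 1 - mat_scale (1 / of_nat n) A_E"
definition "G = A_S - mat_scale (of_nat k / (of_nat m * of_nat n)) (J - A_F)"
definition "e0 = mat_scale (1 / (of_nat f * of_nat m * of_nat n)) J"
definition "eF = mat_scale (1 / (of_nat m * of_nat n)) A_F - e0"
definition "eE = mat_scale (1 / of_nat n) A_E - mat_scale (1 / (of_nat m * of_nat n)) A_F"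

lemma G_entry: "G $ \<alpha> $ \<beta> = (if (\<alpha>, \<beta>) \<in> F then 0 else if (\<alpha>, \<beta>) \<in> S then 1 - of_nat k / (of_nat m * of_nat n)
    else - of_nat k / (of_nat m * of_nat n))"
  using S_not_F by (auto simp: G_def)

lemma N_entry: "N $ \<alpha> $ \<beta> = (if \<alpha> = \<beta> then 1 - 1 / of_nat n else if (\<alpha>, \<beta>) \<in> E then - 1 / of_nat n else 0)"
  by (auto simp: N_def mat_def)

lemma eE_entry: "eE $ \<alpha> $ \<beta> = (if (\<alpha>, \<beta>) \<in> E then 1 / of_nat n - 1 / (of_nat m * of_nat n)
    else if (\<alpha>, \<beta>) \<in> F then - 1 / (of_nat m * of_nat n) else 0)"
  using E_F by (auto simp: eE_def)

lemma eF_entry: "eF $ \<alpha> $ \<beta> = (if (\<alpha>, \<beta>) \<in> F then 1 / (of_nat m * of_nat n) else 0) - 1 / (of_nat f * of_nat m * of_nat n)"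
  by (auto simp: eF_def e0_def)

lemma one_in_algebra: "mat 1 \<in> adjacency_algebra X"
proof -
  have "mat 1 = (adjacency_matrix Id :: complex^'n^'n)" by (simp add: vec_eq_iff mat_def)
  then show ?thesis using adjacency_in_algebra[OF Id_in] by simp
qed

lemmas algebra_closed = cmat.subspace_add[OF subspace_algebra] cmat.subspace_diff[OF subspace_algebra]
  cmat.subspace_scale[OF subspace_algebra]

lemma e0_in: "e0 \<in> adjacency_algebra X" and eF_in: "eF \<in> adjacency_algebra X" and eE_in: "eE \<in> adjacency_algebra X"
  and N_in: "N \<in> adjacency_algebra X" and G_in: "G \<in> adjacency_algebra X"
  unfolding N_def G_def e0_def eF_def eE_def
  by (intro algebra_closed AE_in AF_in AS_in all_ones_in_algebra one_in_algebra)+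

lemma AE_G: "A_E ** G = 0"
  by (simp add: G_def matrix_mult_diff_left AE_AS AE_J AE_AF cmat.scale_right_diff_distrib)

lemma AF_G: "A_F ** G = 0"
  by (simp add: G_def matrix_mult_diff_left AF_AS AF_J AF_AF cmat.scale_right_diff_distrib)

text \<open>\<open>J\<close> is a multiple of \<open>J ** A_F\<close>, and \<open>A_F\<close> kills
  \<open>G\<close>.\<close>

lemma J_G: "J ** G = 0"
proof -
  have "mat_scale (of_nat m * of_nat n) (J ** G) = (J ** A_F) ** G"
    by (simp add: J_AF)
  also have "\<dots> = 0" unfolding matrix_mul_assoc[symmetric] AF_G by simp
  finally show ?thesis by simp
qed

lemma G_zero [simp]: "G ** A_E = 0" "G ** A_F = 0" "G ** J = 0"
  using AE_G AF_G J_G commute_algebra[OF G_in] AE_in AF_in all_ones_in_algebra by metis+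

lemma J_AS: "J ** A_S = mat_scale (of_nat k * (of_nat f - 1)) J"
proof -
  have "mat_scale (of_nat m * of_nat n) (J ** A_S) = (J ** A_F) ** A_S"
    by (simp add: J_AF)
  also have "\<dots> = mat_scale (of_nat k) (J ** (J - A_F))"
    unfolding matrix_mul_assoc[symmetric] AF_AS by simp
  also have "\<dots> = mat_scale (of_nat m * of_nat n) (mat_scale (of_nat k * (of_nat f - 1)) J)"
    by (simp add: matrix_mult_diff_left J_J J_AF vec_eq_iff algebra_simps)
  finally show ?thesis by (subst (asm) cmat.scale_left_imp_eq) auto
qed

text \<open>The coefficients of \<open>N\<close> and \<open>G\<close> in \<open>G ** G\<close>:
  \<open>a\<close> comes from the diagonal of the square, \<open>b\<close> from its entry on
  \<open>T\<close>, which t determines.\<close>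

definition a :: real where "a = real k * (real f - 1) * (real m * real n - real k) / (real m * (real n - 1))"
definition b :: real where "b = real m * real n * real t / real k - (real f - 2) * (real m * real n - real k)"

text \<open>The second form telescopes the five entries along the chain \<open>Id\<close>,
  \<open>E\<close>, \<open>F\<close>, all pairs, with a correction on \<open>S\<close>; it is suited
  to multiplication by \<open>A_E\<close>.\<close>

lemma algebra_entries:
  assumes A: "A \<in> adjacency_algebra X"
  obtains x y z u w where "\<forall>\<alpha> \<beta>. A $ \<alpha> $ \<beta> = (if \<alpha> = \<beta> then x else if (\<alpha>, \<beta>) \<in> E then y
      else if (\<alpha>, \<beta>) \<in> F then z else if (\<alpha>, \<beta>) \<in> S then u else w)"
    and "A = mat_scale (x - y) (mat 1) + mat_scale (y - z) A_E + mat_scale (z - w) A_F + mat_scale w J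
      + mat_scale (u - w) A_S"
proof -
  obtain e1 e2 where e: "(e1, e2) \<in> E - Id" using relation_nonempty[OF basic_in_X(1)] by auto
  obtain f1 f2 where ff: "(f1, f2) \<in> F - E" using relation_nonempty[OF basic_in_X(2)] by auto
  obtain s1 s2 where s: "(s1, s2) \<in> S" using relation_nonempty[OF basic_in_X(3)] by auto
  obtain t1 t2 where t: "(t1, t2) \<in> T" using relation_nonempty[OF basic_in_X(4)] by auto
  define x y z u w where "x = A $ e1 $ e1" and "y = A $ e1 $ e2" and "z = A $ f1 $ f2"
    and "u = A $ s1 $ s2" and "w = A $ t1 $ t2"
  have entry: "A $ \<alpha> $ \<beta> = (if \<alpha> = \<beta> then x else if (\<alpha>, \<beta>) \<in> E then y else if (\<alpha>, \<beta>) \<in> F then z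
      else if (\<alpha>, \<beta>) \<in> S then u else w)" for \<alpha> \<beta>
  proof -
    have "(\<alpha>, \<beta>) \<in> T" if "(\<alpha>, \<beta>) \<notin> F" "(\<alpha>, \<beta>) \<notin> S" using that outside by blast
    then show ?thesis
      using algebra_constant[OF A Id_in, of \<alpha> \<beta> e1 e1] algebra_constant[OF A basic_in_X(1) _ e, of \<alpha> \<beta>]
        algebra_constant[OF A basic_in_X(2) _ ff, of \<alpha> \<beta>] algebra_constant[OF A basic_in_X(3) _ s, of \<alpha> \<beta>]
        algebra_constant[OF A basic_in_X(4) _ t, of \<alpha> \<beta>]
      by (auto simp: x_def y_def z_def u_def w_def)
  qed
  moreover have "A = mat_scale (x - y) (mat 1) + mat_scale (y - z) A_E + mat_scale (z - w) A_F + mat_scale w J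
      + mat_scale (u - w) A_S"
    using E_F S_not_F by (auto simp: vec_eq_iff entry mat_def)
  ultimately show ?thesis using that by blast
qed

text \<open>The square has five unknown entries. Being annihilated by \<open>A_E\<close> leaves two
  of them free; the diagonal entry is found by counting \<open>S\<close>-neighbours and the entry on
  \<open>T\<close> from t.\<close>

lemma G_G: "G ** G = mat_scale (of_real a) N + mat_scale (of_real b) G"
proof -
  define H where "H = G ** G"
  have H_in: "H \<in> adjacency_algebra X" unfolding H_def by (intro mult_in_algebra G_in)
  \<comment> \<open>\<open>G\<close> kills the correction term of the second factor, so that factor
    may be taken to be \<open>A_S\<close>.\<close>
  have H_AS: "H = G ** A_S"
    unfolding H_def by (subst (2) G_def) (simp add: matrix_mult_diff_left)
  obtain x y z u w where "\<forall>\<alpha> \<beta>. H $ \<alpha> $ \<beta> = (if \<alpha> = \<beta> then x else if (\<alpha>, \<beta>) \<in> E then y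
      else if (\<alpha>, \<beta>) \<in> F then z else if (\<alpha>, \<beta>) \<in> S then u else w)"
    and H_lin: "H = mat_scale (x - y) (mat 1) + mat_scale (y - z) A_E + mat_scale (z - w) A_F + mat_scale w J
      + mat_scale (u - w) A_S"
    by (rule algebra_entries[OF H_in])
  note H_entry = this(1)[rule_format]
  obtain f1 f2 where ff: "(f1, f2) \<in> F - E" using relation_nonempty[OF basic_in_X(2)] by auto
  obtain s1 s2 where s: "(s1, s2) \<in> S" using relation_nonempty[OF basic_in_X(3)] by auto
  obtain t1 t2 where t: "(t1, t2) \<in> T" using relation_nonempty[OF basic_in_X(4)] by auto
  have s_E: "(s1, s2) \<notin> E" using S_not_F[OF s] E_F by blast
  have "A_E ** H = 0" by (simp add: H_def matrix_mul_assoc AE_G)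
  then have AE_H: "mat_scale (x - y) A_E + mat_scale ((y - z) * of_nat n) A_E + mat_scale ((z - w) * of_nat n) A_F
      + mat_scale (w * of_nat n) J + mat_scale ((u - w) * of_nat k / of_nat m) (J - A_F) = 0"
    unfolding H_lin by (simp add: matrix_add_ldistrib AE_AE AE_AF AE_J AE_AS)
  \<comment> \<open>Reading the identity on the diagonal, on \<open>F - E\<close> and on
    \<open>S\<close> gives three linear relations, which reduce everything to \<open>x\<close> and
    \<open>w\<close>.\<close>
  have 1: "x - y + y * of_nat n = 0"
    using arg_cong[OF AE_H, of "\<lambda>M. M $ f1 $ f1"] by (simp add: algebra_simps)
  have 2: "z = 0"
    using arg_cong[OF AE_H, of "\<lambda>M. M $ f1 $ f2"] ff by (simp add: algebra_simps)
  have 3: "w * of_nat n + (u - w) * of_nat k / of_nat m = 0"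
    using arg_cong[OF AE_H, of "\<lambda>M. M $ s1 $ s2"] S_not_F[OF s] s_E by (simp add: algebra_simps)
  \<comment> \<open>A point has k(f - 1) neighbours along \<open>S\<close>, and \<open>G\<close> has
    the entry 1 - k/(mn) at each of them.\<close>
  have "x = of_nat k * (of_nat f - 1) * (1 - of_nat k / (of_nat m * of_nat n))"
  proof -
    have "x = (\<Sum>\<gamma>\<in>UNIV. G $ f1 $ \<gamma> * A_S $ \<gamma> $ f1)"
      using H_entry[of f1 f1] by (simp add: H_AS matrix_matrix_mult_def)
    also have "\<dots> = (\<Sum>\<gamma>\<in>UNIV. (1 - of_nat k / (of_nat m * of_nat n)) * (J $ f1 $ \<gamma> * A_S $ \<gamma> $ f1))"
      using sym_relation[OF basic_in_X(3)] S_not_F by (intro sum.cong) (auto simp: G_entry)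
    also have "\<dots> = (1 - of_nat k / (of_nat m * of_nat n)) * (J ** A_S) $ f1 $ f1"
      unfolding sum_distrib_left[symmetric] by (simp add: matrix_matrix_mult_def)
    finally show ?thesis by (simp add: J_AS)
  qed
  also have "\<dots> = of_real a * (1 - 1 / of_nat n)"
    by (simp add: a_def field_simps)
  finally have x: "x = of_real a * (1 - 1 / of_nat n)" .
  have y: "y = - of_real a / of_nat n"
  proof -
    have "y * (of_nat n - 1) = - x" using 1 by (simp add: algebra_simps add_eq_0_iff)
    also have "\<dots> = (- of_real a / of_nat n) * (of_nat n - 1)" unfolding x by (simp add: field_simps)
    finally show ?thesis by (subst (asm) mult_cancel_right) simp
  qed
  \<comment> \<open>Written in terms of \<open>G\<close>, the product of the matrices of
    \<open>T\<close> and \<open>S\<close> contains \<open>H\<close>. Its entry at a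
    \<open>T\<close>-pair is t, which determines \<open>w\<close>.\<close>
  have w: "w = - (of_nat k / (of_nat m * of_nat n)) * of_real b"
  proof -
    define q :: complex where "q = of_nat k / (of_nat m * of_nat n)"
    have AT: "adjacency_matrix T = mat_scale (1 - q) (J - A_F) - G"
      using outside S_not_F T_not_F S_T_disjoint by (auto simp: vec_eq_iff G_entry q_def)
    have "of_nat t = (adjacency_matrix T ** A_S) $ t1 $ t2"
      unfolding adjacency_matrix_mult_entry t_eq using intersection_number_eq[OF basic_in_X(4,3,4) t] by simp
    also have "adjacency_matrix T ** A_S = mat_scale (1 - q) (J ** A_S - A_F ** A_S) - H"
      unfolding AT H_AS by (simp add: matrix_mult_diff_right)
    also have "\<dots> $ t1 $ t2 = (1 - q) * (of_nat k * (of_nat f - 1) - of_nat k) - w"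
      using T_not_F[OF t] S_T_disjoint t E_F refl_F H_entry[of t1 t2] by (auto simp: J_AS AF_AS)
    finally have "w = (1 - q) * (of_nat k * (of_nat f - 1) - of_nat k) - of_nat t"
      by simp
    also have "\<dots> = - (of_nat k / (of_nat m * of_nat n)) * of_real b"
      by (simp add: b_def q_def field_simps)
    finally show ?thesis .
  qed
  \<comment> \<open>With \<open>w\<close> known, the third relation yields \<open>u\<close> after
    division by k.\<close>
  have u: "u = (1 - of_nat k / (of_nat m * of_nat n)) * of_real b"
  proof -
    have "u * of_nat k = (w * of_nat k - w * of_nat n * of_nat m)"
      using 3 by (simp add: field_simps)
    also have "\<dots> = (1 - of_nat k / (of_nat m * of_nat n)) * of_real b * of_nat k"
      unfolding w by (simp add: field_simps)
    finally show ?thesis by (subst (asm) mult_cancel_right) simp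
  qed
  show ?thesis
    unfolding H_def[symmetric] using E_F
    by (auto simp: vec_eq_iff H_entry N_entry G_entry x y 2 u w)
qed

section \<open>Multiplication table of the idempotents\<close>

lemmas products = AE_AE AE_AF AF_AE AF_AF AE_J J_AE AF_J J_AF J_J AE_G AF_G J_G

lemma AF_e0: "A_F ** e0 = mat_scale (of_nat m * of_nat n) e0"
  and AF_eF: "A_F ** eF = mat_scale (of_nat m * of_nat n) eF"
  and AF_eE: "A_F ** eE = 0" and AF_N: "A_F ** N = 0"
  by (simp_all add: e0_def eF_def eE_def N_def matrix_distribs products cmat.scale_right_diff_distrib)

lemma e0_products: "e0 ** e0 = e0" "e0 ** eF = 0" "e0 ** eE = 0" "e0 ** N = 0" "e0 ** G = 0"
  by (simp_all add: e0_def eF_def eE_def N_def matrix_distribs products cmat.scale_right_diff_distrib)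

lemma eF_mult: "eF ** M = mat_scale (1 / (of_nat m * of_nat n)) (A_F ** M) - e0 ** M"
  and eE_mult: "eE ** M = mat_scale (1 / of_nat n) (A_E ** M) - mat_scale (1 / (of_nat m * of_nat n)) (A_F ** M)"
  and N_mult: "N ** M = M - mat_scale (1 / of_nat n) (A_E ** M)"
  by (simp_all add: eF_def eE_def N_def matrix_mult_diff_right)

lemma eF_products: "eF ** eF = eF" "eF ** eE = 0" "eF ** N = 0" "eF ** G = 0"
  by (simp_all add: eF_mult AF_eF AF_eE AF_N AF_G e0_products)

lemma AE_eE: "A_E ** eE = mat_scale (of_nat n) eE" and AE_N: "A_E ** N = 0"
  by (simp_all add: eE_def N_def matrix_distribs products cmat.scale_right_diff_distrib)

lemma eE_products: "eE ** eE = eE" "eE ** N = 0" "eE ** G = 0"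
  by (simp_all add: eE_mult AE_eE AF_eE AE_N AF_N AE_G AF_G)

lemma N_products: "N ** N = N" "N ** G = G"
  by (simp_all add: N_mult AE_N AE_G)

lemma G_N: "G ** N = G"
  using N_products commute_algebra[OF G_in N_in] by simp

text \<open>Lagrange interpolation on the image of \<open>N\<close>: this is (G - \<tau>
  N)/(\<theta> - \<tau>). For the two roots of x^2 = b x + a it is the projection onto the
  eigenspace of \<open>G\<close> for \<theta>.\<close>

definition P :: "real \<Rightarrow> real \<Rightarrow> complex^'n^'n" where
  "P \<theta> \<tau> = mat_scale (of_real (- \<tau> / (\<theta> - \<tau>))) N + mat_scale (of_real (1 / (\<theta> - \<tau>))) G"

lemma P_in: "P \<theta> \<tau> \<in> adjacency_algebra X"
  unfolding P_def by (intro algebra_closed N_in G_in)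

definition "roots \<theta> \<tau> \<longleftrightarrow> \<theta> + \<tau> = b \<and> \<theta> * \<tau> = - a \<and> \<theta> \<noteq> \<tau>"

lemma roots_commute: "roots \<theta> \<tau> \<Longrightarrow> roots \<tau> \<theta>"
  by (simp add: roots_def algebra_simps)

text \<open>Positivity makes the two roots real, distinct and of opposite sign.\<close>

lemma a_pos: "0 < a"
proof -
  have "real k < real m * real n" using k_less by (metis of_nat_less_iff of_nat_mult)
  then show ?thesis using k_pos f_ge m_ge n_ge by (simp add: a_def)
qed

lemma roots_nonzero: "roots \<theta> \<tau> \<Longrightarrow> \<theta> \<noteq> 0" "roots \<theta> \<tau> \<Longrightarrow> \<tau> \<noteq> 0"
  using a_pos by (auto simp: roots_def)

lemma ex_roots: "\<exists>\<theta> \<tau>. roots \<theta> \<tau>"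
proof -
  define D where "D = sqrt (b\<^sup>2 + 4 * a)"
  have D: "D\<^sup>2 = b\<^sup>2 + 4 * a" "D > 0"
    using a_pos by (simp_all add: D_def add_nonneg_pos)
  then have "roots ((b + D) / 2) ((b - D) / 2)"
    by (simp add: roots_def field_simps power2_eq_square)
  then show ?thesis by blast
qed

text \<open>\<open>N\<close> acts as a unit on \<open>G\<close>, and \<open>G_G\<close> reduces the
  square of \<open>G\<close>; products become arithmetic on pairs of coefficients.\<close>

lemma NG_mult: "(mat_scale p N + mat_scale q G) ** (mat_scale p' N + mat_scale q' G) =
    mat_scale (p * p' + of_real a * q * q') N + mat_scale (p * q' + q * p' + of_real b * q * q') G"
  by (simp add: matrix_distribs N_products G_N G_G vec_eq_iff algebra_simps)

lemma P_products:
  assumes "roots \<theta> \<tau>"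
  shows "P \<theta> \<tau> ** P \<theta> \<tau> = P \<theta> \<tau>" "P \<theta> \<tau> ** P \<tau> \<theta> = 0"
proof -
  define d where "d = \<theta> - \<tau>"
  have d: "d \<noteq> 0" "\<tau> - \<theta> = - d" and a: "a = - (\<theta> * \<tau>)" and b: "b = \<theta> + \<tau>"
    using assms by (auto simp: roots_def d_def)
  have "(- \<tau> / d) * (- \<tau> / d) + a * (1 / d) * (1 / d) = - \<tau> / d"
    using d(1) unfolding a by (simp add: field_simps) (simp add: d_def algebra_simps)
  moreover have "(- \<tau> / d) * (1 / d) + (1 / d) * (- \<tau> / d) + b * (1 / d) * (1 / d) = 1 / d"
    using d(1) unfolding b by (simp add: field_simps) (simp add: d_def algebra_simps)
  ultimately show "P \<theta> \<tau> ** P \<theta> \<tau> = P \<theta> \<tau>"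
    unfolding P_def NG_mult d_def[symmetric] by (simp only: of_real_mult[symmetric] of_real_add[symmetric])
  have "(- \<tau> / d) * (- \<theta> / - d) + a * (1 / d) * (1 / - d) = 0"
    using d(1) unfolding a by (simp add: field_simps)
  moreover have "(- \<tau> / d) * (1 / - d) + (1 / d) * (- \<theta> / - d) + b * (1 / d) * (1 / - d) = 0"
    using d(1) unfolding b by (simp add: field_simps)
  ultimately show "P \<theta> \<tau> ** P \<tau> \<theta> = 0"
    unfolding P_def NG_mult d_def[symmetric] d(2)
    by (simp only: of_real_mult[symmetric] of_real_add[symmetric]) simp
qed

lemma other_P_products: "e0 ** P \<theta> \<tau> = 0" "eF ** P \<theta> \<tau> = 0" "eE ** P \<theta> \<tau> = 0" "A_F ** P \<theta> \<tau> = 0"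
  by (simp_all add: P_def matrix_distribs e0_products eF_products eE_products AF_N AF_G)

lemmas idempotent_products = e0_products eF_products eE_products other_P_products P_products

lemma idempotent_products': "eF ** e0 = 0" "eE ** e0 = 0" "P \<theta> \<tau> ** e0 = 0" "eE ** eF = 0" "P \<theta> \<tau> ** eF = 0"
  "P \<theta> \<tau> ** eE = 0"
  using commute_algebra[OF e0_in eF_in] commute_algebra[OF e0_in eE_in] commute_algebra[OF e0_in P_in[of \<theta> \<tau>]]
    commute_algebra[OF eF_in eE_in] commute_algebra[OF eF_in P_in[of \<theta> \<tau>]] commute_algebra[OF eE_in P_in[of \<theta> \<tau>]]
  by (simp_all add: e0_products eF_products eE_products other_P_products)

lemma P_entry: "P \<theta> \<tau> $ \<alpha> $ \<beta> = (if (\<alpha>, \<beta>) \<in> F then of_real (- \<tau> / (\<theta> - \<tau>)) * N $ \<alpha> $ \<beta>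
    else of_real (1 / (\<theta> - \<tau>)) * G $ \<alpha> $ \<beta>)"
  using E_F by (auto simp: P_def N_entry G_entry)

lemma diagonal_entry:
  shows "e0 $ \<alpha> $ \<alpha> \<noteq> 0" "eF $ \<alpha> $ \<alpha> \<noteq> 0" "eE $ \<alpha> $ \<alpha> \<noteq> 0" "roots \<theta> \<tau> \<Longrightarrow> P \<theta> \<tau> $ \<alpha> $ \<alpha> \<noteq> 0"
  using roots_nonzero(2)[of \<theta> \<tau>]
  by (auto simp: e0_def eF_entry eE_entry P_entry N_entry roots_def divide_simps)

lemma real_entry:
  shows "e0 $ \<alpha> $ \<beta> \<in> \<real>" "eF $ \<alpha> $ \<beta> \<in> \<real>" "eE $ \<alpha> $ \<beta> \<in> \<real>" "N $ \<alpha> $ \<beta> \<in> \<real>" "G $ \<alpha> $ \<beta> \<in> \<real>" "P \<theta> \<tau> $ \<alpha> $ \<beta> \<in> \<real>"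
proof -
  show N: "N $ \<alpha> $ \<beta> \<in> \<real>" unfolding N_entry by (simp add: Reals_divide Reals_diff)
  show G: "G $ \<alpha> $ \<beta> \<in> \<real>" unfolding G_entry by (simp add: Reals_divide Reals_diff Reals_mult)
  show "P \<theta> \<tau> $ \<alpha> $ \<beta> \<in> \<real>"
    unfolding P_entry using N G by (auto intro!: Reals_mult simp del: of_real_divide of_real_minus)
qed (auto simp: e0_def eF_entry eE_entry intro!: Reals_divide Reals_diff Reals_mult)

text \<open>The relation that \<open>\<sim>\<^sub>I\<close> induces on the primitive idempotents when \<open>E(I) = F\<close>.\<close>

definition "linked M M' \<longleftrightarrow> A_F ** hadamard M M' \<noteq> 0"

lemma linked_commute: "linked M M' \<longleftrightarrow> linked M' M"
proof -
  have "hadamard M M' = hadamard M' M" by (simp add: vec_eq_iff mult.commute)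
  then show ?thesis by (simp add: linked_def)
qed

text \<open>The real part of a diagonal entry of the product is a sum over one class of
  \<open>F\<close>, with a positive term and no negative one.\<close>

lemma linkedI:
  assumes "\<And>\<gamma>. (\<alpha>, \<gamma>) \<in> F \<Longrightarrow> 0 \<le> Re (M $ \<gamma> $ \<alpha> * M' $ \<gamma> $ \<alpha>)" "0 < Re (M $ \<alpha> $ \<alpha> * M' $ \<alpha> $ \<alpha>)"
  shows "linked M M'"
proof -
  have "0 < (\<Sum>\<gamma> | (\<alpha>, \<gamma>) \<in> F. Re (M $ \<gamma> $ \<alpha> * M' $ \<gamma> $ \<alpha>))"
    using assms by (intro sum_pos2[of _ \<alpha>]) auto
  also have "\<dots> = Re ((A_F ** hadamard M M') $ \<alpha> $ \<alpha>)"
    unfolding adjacency_mult_entry by simp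
  finally show ?thesis
    unfolding linked_def by auto
qed

lemma linked_self:
  assumes "\<And>\<alpha> \<beta>. M $ \<alpha> $ \<beta> \<in> \<real>" "\<And>\<alpha>. M $ \<alpha> $ \<alpha> \<noteq> 0"
  shows "linked M M"
proof -
  have sq: "Re (M $ \<alpha> $ \<beta> * M $ \<alpha> $ \<beta>) = (Re (M $ \<alpha> $ \<beta>))\<^sup>2" for \<alpha> \<beta>
    using assms(1)[of \<alpha> \<beta>] by (simp add: complex_is_Real_iff power2_eq_square)
  have "Re (M $ \<alpha> $ \<alpha>) \<noteq> 0" for \<alpha>
    using assms(1)[of \<alpha> \<alpha>] assms(2)[of \<alpha>] by (simp add: complex_is_Real_iff complex_eq_iff)
  then show ?thesis
    by (intro linkedI[of undefined]) (simp_all only: sq zero_le_power2 zero_less_power2 not_False_eq_True)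
qed

text \<open>A factor that is constant along the classes of \<open>F\<close> comes out of the sum
  over a class, which leaves an entry of \<open>A_F ** M'\<close>.\<close>

lemma not_linked_block:
  assumes M: "\<And>\<alpha> \<beta> \<gamma>. (\<alpha>, \<gamma>) \<in> F \<Longrightarrow> M $ \<gamma> $ \<beta> = M $ \<alpha> $ \<beta>" and M': "A_F ** M' = 0"
  shows "\<not> linked M M'"
proof -
  have "(A_F ** hadamard M M') $ \<alpha> $ \<beta> = 0" for \<alpha> \<beta>
  proof -
    have "(A_F ** hadamard M M') $ \<alpha> $ \<beta> = (\<Sum>\<gamma> | (\<alpha>, \<gamma>) \<in> F. M $ \<alpha> $ \<beta> * M' $ \<gamma> $ \<beta>)"
      unfolding adjacency_mult_entry using M by (intro sum.cong) auto
    also have "\<dots> = M $ \<alpha> $ \<beta> * (A_F ** M') $ \<alpha> $ \<beta>"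
      unfolding adjacency_mult_entry by (simp add: sum_distrib_left)
    finally show ?thesis by (simp add: M')
  qed
  then show ?thesis by (simp add: linked_def vec_eq_iff)
qed

lemma e0_block: "(\<alpha>, \<gamma>) \<in> F \<Longrightarrow> e0 $ \<gamma> $ \<beta> = e0 $ \<alpha> $ \<beta>"
  by (simp add: e0_def)

lemma eF_block: "(\<alpha>, \<gamma>) \<in> F \<Longrightarrow> eF $ \<gamma> $ \<beta> = eF $ \<alpha> $ \<beta>"
  using F_block[of \<alpha> \<gamma> \<beta> \<beta>] by (simp add: eF_entry)

text \<open>Self-links come from sums of squares, and most missing links from
  \<open>not_linked_block\<close>. Two cases are special. On \<open>F\<close> the two projections of
  \<open>G\<close> are multiples of \<open>N\<close> whose coefficients have the same sign, so they
  are linked. And \<open>eE\<close> is constant on \<open>E\<close>, outside which the part of a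
  projection inside \<open>F\<close> vanishes, so their entrywise product is a multiple of
  \<open>N\<close>, which \<open>A_F\<close> kills.\<close>

lemma linked_idempotents:
  assumes r: "roots \<theta> \<tau>"
  shows "linked e0 e0" "linked eF eF" "linked eE eE" "linked (P \<theta> \<tau>) (P \<theta> \<tau>)" "linked e0 eF"
    "linked (P \<theta> \<tau>) (P \<tau> \<theta>)" "\<not> linked e0 eE" "\<not> linked e0 (P \<theta> \<tau>)" "\<not> linked eF eE" "\<not> linked eF (P \<theta> \<tau>)"
    "\<not> linked eE (P \<theta> \<tau>)"
proof -
  show "linked e0 e0" "linked eF eF" "linked eE eE" "linked (P \<theta> \<tau>) (P \<theta> \<tau>)"
    using r by (intro linked_self real_entry diagonal_entry; simp)+
  show "\<not> linked e0 eE" "\<not> linked e0 (P \<theta> \<tau>)" "\<not> linked eF eE" "\<not> linked eF (P \<theta> \<tau>)"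
    by (intro not_linked_block e0_block eF_block AF_eE other_P_products(4); assumption)+
  have "hadamard e0 eF = mat_scale (1 / (of_nat f * of_nat m * of_nat n)) eF"
    by (simp add: vec_eq_iff e0_def)
  moreover have "eF \<noteq> 0" using diagonal_entry(2)[of undefined] by auto
  ultimately show "linked e0 eF" by (simp add: linked_def AF_eF)
  show "linked (P \<theta> \<tau>) (P \<tau> \<theta>)"
  proof (rule linkedI)
    \<comment> \<open>The product of the two coefficients of \<open>N\<close>; it equals a/(\<theta>
      - \<tau>)^2 and is therefore positive.\<close>
    define q where "q = (- \<tau> / (\<theta> - \<tau>)) * (- \<theta> / (\<tau> - \<theta>))"
    have "q = a / (\<theta> - \<tau>)\<^sup>2"
    proof -
      have "- \<theta> / (\<tau> - \<theta>) = \<theta> / (\<theta> - \<tau>)" using r by (simp add: roots_def divide_simps) (simp add: algebra_simps)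
      moreover have "a = - (\<theta> * \<tau>)" using r by (simp add: roots_def)
      ultimately show ?thesis by (simp add: q_def power2_eq_square)
    qed
    then have q: "0 < q" using a_pos r by (simp add: roots_def)
    have eq: "Re (P \<theta> \<tau> $ \<gamma> $ \<alpha> * P \<tau> \<theta> $ \<gamma> $ \<alpha>) = q * (Re (N $ \<gamma> $ \<alpha>))\<^sup>2" if "(\<gamma>, \<alpha>) \<in> F" for \<gamma> \<alpha>
    proof -
      have "P \<theta> \<tau> $ \<gamma> $ \<alpha> * P \<tau> \<theta> $ \<gamma> $ \<alpha> = of_real q * (N $ \<gamma> $ \<alpha> * N $ \<gamma> $ \<alpha>)"
        using that by (simp add: P_entry q_def)
      moreover have "Im (N $ \<gamma> $ \<alpha>) = 0" using real_entry(4) by (simp add: complex_is_Real_iff)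
      ultimately show ?thesis by (simp add: power2_eq_square)
    qed
    show "0 \<le> Re (P \<theta> \<tau> $ \<gamma> $ undefined * P \<tau> \<theta> $ \<gamma> $ undefined)" if "(undefined, \<gamma>) \<in> F" for \<gamma>
      using eq[OF sym_F[OF that]] q by simp
    have "Re (N $ undefined $ undefined) \<noteq> 0"
    proof -
      have "N $ undefined $ undefined = of_real (1 - 1 / real n)" by (simp add: N_entry)
      then have "Re (N $ undefined $ undefined) = 1 - 1 / real n" by (simp only: Re_complex_of_real)
      then show ?thesis using n_ge by simp
    qed
    then show "0 < Re (P \<theta> \<tau> $ undefined $ undefined * P \<tau> \<theta> $ undefined $ undefined)"
      using eq[of undefined undefined] q by simp
  qed
  define q :: complex where "q = (1 / of_nat n - 1 / (of_nat m * of_nat n)) * of_real (- \<tau> / (\<theta> - \<tau>))"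
  have "hadamard eE (P \<theta> \<tau>) = mat_scale q N"
    using E_F by (auto simp: vec_eq_iff eE_entry P_entry N_entry q_def)
  then show "\<not> linked eE (P \<theta> \<tau>)" by (simp add: linked_def AF_N)
qed

text \<open>The order puts linked idempotents at the places i and 4 - i, and \<open>eE\<close>,
  which is linked only to itself, in the middle.\<close>

definition "std \<theta> \<tau> i = [e0, P \<theta> \<tau>, eE, P \<tau> \<theta>, eF] ! i"

lemma atMost_4: "{..4::nat} = {0, 1, 2, 3, 4}"
  by auto

lemma std_simps: "std \<theta> \<tau> 0 = e0" "std \<theta> \<tau> 1 = P \<theta> \<tau>" "std \<theta> \<tau> 2 = eE" "std \<theta> \<tau> 3 = P \<tau> \<theta>" "std \<theta> \<tau> 4 = eF"
  by (simp_all add: std_def)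

lemma std_orthogonal:
  assumes r: "roots \<theta> \<tau>"
  shows "orthogonal_idempotents (std \<theta> \<tau>) 4"
proof
  have nz: "e0 \<noteq> 0" "eF \<noteq> 0" "eE \<noteq> 0" "P \<theta> \<tau> \<noteq> 0" "P \<tau> \<theta> \<noteq> 0"
    using diagonal_entry(1-3)[of undefined] diagonal_entry(4)[OF r, of undefined]
      diagonal_entry(4)[OF roots_commute[OF r], of undefined] by auto
  fix i :: nat assume "i \<le> 4"
  then have i: "i \<in> {0, 1, 2, 3, 4}" by auto
  then show "std \<theta> \<tau> i \<noteq> 0" using nz by (auto simp: std_simps[simplified])
  fix j :: nat assume "j \<le> 4"
  then have "j \<in> {0, 1, 2, 3, 4}" by auto
  with i show "std \<theta> \<tau> i ** std \<theta> \<tau> j = (if i = j then std \<theta> \<tau> i else 0)"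
    using P_products[OF r] P_products[OF roots_commute[OF r]]
    by (elim insertE emptyE; simp add: std_simps[simplified] idempotent_products idempotent_products')
qed

lemma std_image: "std \<theta> \<tau> ` {..4} = {e0, P \<theta> \<tau>, eE, P \<tau> \<theta>, eF}"
  unfolding atMost_4 by (auto simp: std_simps[simplified])

text \<open>The idempotents recover \<open>J\<close>, \<open>A_F\<close> and \<open>A_E\<close> from
  the averaging projections, and \<open>N\<close> and \<open>G\<close> as spectral sums of the two
  projections. From these come \<open>A_S\<close> and the identity matrix, and these five matrices
  generate the algebra.\<close>

lemma std_span:
  assumes r: "roots \<theta> \<tau>"
  shows "adjacency_algebra X = cmat.span (std \<theta> \<tau> ` {..4})"
proof
  let ?V = "cmat.span (std \<theta> \<tau> ` {..4})"
  have base: "e0 \<in> ?V" "P \<theta> \<tau> \<in> ?V" "eE \<in> ?V" "P \<tau> \<theta> \<in> ?V" "eF \<in> ?V"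
    unfolding std_image by (rule cmat.span_base, simp)+
  note closed = cmat.span_add[where S = "std \<theta> \<tau> ` {..4}"] cmat.span_diff[where S = "std \<theta> \<tau> ` {..4}"]
    cmat.span_scale[where S = "std \<theta> \<tau> ` {..4}"]
  have J: "J \<in> ?V"
  proof -
    have "J = mat_scale (of_nat f * of_nat m * of_nat n) e0" by (simp add: e0_def)
    then show ?thesis using closed(3)[OF base(1)] by metis
  qed
  have AF: "A_F \<in> ?V"
  proof -
    have "A_F = mat_scale (of_nat m * of_nat n) (eF + e0)" by (simp add: eF_def)
    then show ?thesis using closed base by simp
  qed
  have AE: "A_E \<in> ?V"
  proof -
    have "A_E = mat_scale (of_nat n) (eE + mat_scale (1 / (of_nat m * of_nat n)) A_F)" by (simp add: eE_def)
    then show ?thesis using closed base AF by simp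
  qed
  have d: "of_real \<theta> - of_real \<tau> \<noteq> (0 :: complex)" "of_real \<tau> - of_real \<theta> \<noteq> (0 :: complex)"
    using r by (auto simp: roots_def)
  have N: "N \<in> ?V"
  proof -
    have "N = P \<theta> \<tau> + P \<tau> \<theta>"
      using d by (simp add: P_def vec_eq_iff divide_simps) (simp add: algebra_simps)
    then show ?thesis using closed base by simp
  qed
  have G: "G \<in> ?V"
  proof -
    have "G = mat_scale (of_real \<theta>) (P \<theta> \<tau>) + mat_scale (of_real \<tau>) (P \<tau> \<theta>)"
      using d by (simp add: P_def vec_eq_iff divide_simps) (simp add: algebra_simps)
    then show ?thesis using closed base by simp
  qed
  have AS: "A_S \<in> ?V"
  proof -
    have "A_S = G + mat_scale (of_nat k / (of_nat m * of_nat n)) (J - A_F)" by (simp add: G_def)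
    then show ?thesis using closed G J AF by simp
  qed
  have I: "mat 1 \<in> ?V"
  proof -
    have "mat 1 = N + mat_scale (1 / of_nat n) A_E" by (simp add: N_def)
    then show ?thesis using closed N AE by simp
  qed
  show "adjacency_algebra X \<subseteq> ?V"
  proof
    fix A assume "A \<in> adjacency_algebra X"
    then obtain x y z u w where A: "A = mat_scale (x - y) (mat 1) + mat_scale (y - z) A_E + mat_scale (z - w) A_F
        + mat_scale w J + mat_scale (u - w) A_S"
      by (rule algebra_entries)
    show "A \<in> ?V" unfolding A by (intro closed I AE AF J AS)
  qed
  show "?V \<subseteq> adjacency_algebra X"
    unfolding std_image using e0_in eF_in eE_in P_in subspace_algebra by (intro cmat.span_minimal) auto
qed

lemma primitive_idempotents:
  assumes "roots \<theta> \<tau>"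
  shows "primitive_idempotents X = {e0, P \<theta> \<tau>, eE, P \<tau> \<theta>, eF}"
  using orthogonal_idempotents.primitive_idempotents_eq[OF std_orthogonal[OF assms] std_span[OF assms]]
  by (simp add: std_image)

end

section \<open>The Q-Higmanian condition\<close>

context higman
begin

section \<open>Ranks of the primitive idempotents\<close>

lemma traces: "trace J = of_nat f * of_nat m * of_nat n" "trace A_E = of_nat f * of_nat m * of_nat n"
  "trace A_F = of_nat f * of_nat m * of_nat n" "trace (mat 1 :: complex^'n^'n) = of_nat f * of_nat m * of_nat n"
  "trace G = 0"
  using card_points by (simp_all add: trace_def mat_def G_entry)

lemma rank_e0: "rank e0 = 1"
proof -
  have "of_nat (rank e0) = (1 :: complex)"
    unfolding rank_idempotent_eq_trace[OF e0_products(1)] by (simp add: e0_def trace_mat_scale traces)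
  then show ?thesis by simp
qed

lemma rank_eF: "rank eF = f - 1"
proof -
  have "of_nat (rank eF) = (of_nat f - 1 :: complex)"
    unfolding rank_idempotent_eq_trace[OF eF_products(1)]
    by (simp add: eF_def e0_def trace_sub trace_mat_scale traces)
  also have "\<dots> = of_nat (f - 1)" using f_ge by (simp add: of_nat_diff)
  finally show ?thesis by (simp only: of_nat_eq_iff)
qed

text \<open>Since \<open>G\<close> has trace 0, only the coefficient of \<open>N\<close> contributes
  to the trace.\<close>

lemma rank_P:
  assumes "roots \<theta> \<tau>"
  shows "real (rank (P \<theta> \<tau>)) = - \<tau> / (\<theta> - \<tau>) * (real f * real m * (real n - 1))"
proof -
  have "trace N = of_nat f * of_nat m * (of_nat n - 1)"
    by (simp add: N_def trace_sub trace_mat_scale traces field_simps)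
  then have "of_nat (rank (P \<theta> \<tau>)) = complex_of_real (- \<tau> / (\<theta> - \<tau>)) * (of_nat f * of_nat m * (of_nat n - 1))"
    unfolding rank_idempotent_eq_trace[OF P_products(1)[OF assms]]
    by (simp only: P_def trace_add trace_mat_scale traces mult_zero_right add_0_right)
  also have "\<dots> = of_real (- \<tau> / (\<theta> - \<tau>) * (real f * real m * (real n - 1)))"
    by simp
  finally show ?thesis
    by (metis of_real_eq_iff of_real_of_nat_eq)
qed

text \<open>The ranks are -\<tau> K and \<theta> K with a common nonzero factor \<open>K\<close>, so
  the rank condition becomes linear in the roots.\<close>

lemma rank_ratio:
  assumes r: "roots \<theta> \<tau>"
  shows "int (rank (P \<tau> \<theta>)) = (int f - 1) * int (rank (P \<theta> \<tau>)) \<longleftrightarrow> \<theta> = - (real f - 1) * \<tau>"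
proof -
  define K where "K = real f * real m * (real n - 1) / (\<theta> - \<tau>)"
  have K: "K \<noteq> 0" using r f_ge m_ge n_ge by (simp add: K_def roots_def)
  have 1: "real (rank (P \<theta> \<tau>)) = - \<tau> * K" unfolding rank_P[OF r] K_def by simp
  have "- \<theta> / (\<tau> - \<theta>) = \<theta> / (\<theta> - \<tau>)"
    using r by (simp add: roots_def divide_simps) (simp add: algebra_simps)
  then have 2: "real (rank (P \<tau> \<theta>)) = \<theta> * K" unfolding rank_P[OF roots_commute[OF r]] K_def by simp
  have "int (rank (P \<tau> \<theta>)) = (int f - 1) * int (rank (P \<theta> \<tau>)) \<longleftrightarrow>
      real_of_int (int (rank (P \<tau> \<theta>))) = real_of_int ((int f - 1) * int (rank (P \<theta> \<tau>)))"
    by (simp only: of_int_eq_iff)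
  also have "\<dots> \<longleftrightarrow> \<theta> * K = (real f - 1) * (- \<tau> * K)"
    using 1 2 by simp
  also have "(real f - 1) * (- \<tau> * K) = (- (real f - 1) * \<tau>) * K"
    by (simp add: algebra_simps)
  also have "\<theta> * K = (- (real f - 1) * \<tau>) * K \<longleftrightarrow> \<theta> = - (real f - 1) * \<tau>"
    unfolding mult_cancel_right using K by blast
  finally show ?thesis .
qed

section \<open>The entrywise subalgebra that belongs to \<open>F\<close>\<close>

lemma card_quotient_F: "card (UNIV // F) = f"
proof -
  have "CARD('n) = (\<Sum>C\<in>UNIV // F. card C)"
    by (rule product_partition[OF partition_on_quotient[OF equiv_F]]) simp
  also have "\<dots> = (\<Sum>C\<in>UNIV // F. m * n)"
    by (rule sum.cong) (auto elim!: quotientE simp: card_F)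
  finally show ?thesis using card_points by simp
qed

text \<open>A block-constant member takes one value on \<open>Id\<close>, \<open>E - Id\<close> and
  \<open>F - E\<close>. It also agrees on \<open>S\<close> and \<open>T\<close>, because some
  product of two classes of \<open>E\<close> meets both. Two values remain, and these are accounted
  for by \<open>A_F\<close> and \<open>J\<close>.\<close>

lemma block_span: "cmat.span {e0, eF} = {A \<in> adjacency_algebra X. constant_on_blocks F A}"
proof
  have "cmat.subspace {A \<in> adjacency_algebra X. constant_on_blocks F A}"
  proof (rule cmat.subspaceI)
    show "0 \<in> {A \<in> adjacency_algebra X. constant_on_blocks F A}"
      using cmat.subspace_0[OF subspace_algebra] by (simp add: constant_on_blocks_iff[OF equiv_F])
  next
    fix A B assume "A \<in> {A \<in> adjacency_algebra X. constant_on_blocks F A}"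
      "B \<in> {A \<in> adjacency_algebra X. constant_on_blocks F A}"
    then have "A \<in> adjacency_algebra X" "B \<in> adjacency_algebra X"
      and c: "(\<alpha>, \<alpha>') \<in> F \<Longrightarrow> (\<beta>, \<beta>') \<in> F \<Longrightarrow> A $ \<alpha> $ \<beta> = A $ \<alpha>' $ \<beta>' \<and> B $ \<alpha> $ \<beta> = B $ \<alpha>' $ \<beta>'" for \<alpha> \<alpha>' \<beta> \<beta>'
      unfolding constant_on_blocks_iff[OF equiv_F] by blast+
    then show "A + B \<in> {A \<in> adjacency_algebra X. constant_on_blocks F A}"
      by (auto simp: constant_on_blocks_iff[OF equiv_F] intro!: algebra_closed(1) arg_cong2[where f = "(+)"] dest: c)
  next
    fix q A assume "A \<in> {A \<in> adjacency_algebra X. constant_on_blocks F A}"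
    then have "A \<in> adjacency_algebra X"
      and c: "(\<alpha>, \<alpha>') \<in> F \<Longrightarrow> (\<beta>, \<beta>') \<in> F \<Longrightarrow> A $ \<alpha> $ \<beta> = A $ \<alpha>' $ \<beta>'" for \<alpha> \<alpha>' \<beta> \<beta>'
      unfolding constant_on_blocks_iff[OF equiv_F] by blast+
    then show "mat_scale q A \<in> {A \<in> adjacency_algebra X. constant_on_blocks F A}"
      by (auto simp: constant_on_blocks_iff[OF equiv_F] intro!: algebra_closed(3) dest: c)
  qed
  moreover have "constant_on_blocks F e0"
    by (simp add: constant_on_blocks_iff[OF equiv_F] e0_def)
  moreover have "constant_on_blocks F eF"
    unfolding constant_on_blocks_iff[OF equiv_F]
  proof (intro allI impI)
    fix \<alpha> \<alpha>' \<beta> \<beta>' assume "(\<alpha>, \<alpha>') \<in> F" "(\<beta>, \<beta>') \<in> F"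
    then have "(\<alpha>, \<beta>) \<in> F \<longleftrightarrow> (\<alpha>', \<beta>') \<in> F" by (rule F_block)
    then show "eF $ \<alpha> $ \<beta> = eF $ \<alpha>' $ \<beta>'" by (simp add: eF_entry)
  qed
  ultimately show "cmat.span {e0, eF} \<subseteq> {A \<in> adjacency_algebra X. constant_on_blocks F A}"
    using e0_in eF_in by (intro cmat.span_minimal) auto
  show "{A \<in> adjacency_algebra X. constant_on_blocks F A} \<subseteq> cmat.span {e0, eF}"
  proof
    fix A assume "A \<in> {A \<in> adjacency_algebra X. constant_on_blocks F A}"
    then have A: "A \<in> adjacency_algebra X"
      and c: "(\<alpha>, \<alpha>') \<in> F \<Longrightarrow> (\<beta>, \<beta>') \<in> F \<Longrightarrow> A $ \<alpha> $ \<beta> = A $ \<alpha>' $ \<beta>'" for \<alpha> \<alpha>' \<beta> \<beta>'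
      unfolding constant_on_blocks_iff[OF equiv_F] by blast+
    obtain x y z u w where "\<forall>\<alpha> \<beta>. A $ \<alpha> $ \<beta> = (if \<alpha> = \<beta> then x else if (\<alpha>, \<beta>) \<in> E then y
        else if (\<alpha>, \<beta>) \<in> F then z else if (\<alpha>, \<beta>) \<in> S then u else w)"
      and lin: "A = mat_scale (x - y) (mat 1) + mat_scale (y - z) A_E + mat_scale (z - w) A_F + mat_scale w J
        + mat_scale (u - w) A_S"
      by (rule algebra_entries[OF A])
    note entry = this(1)[rule_format]
    obtain e1 e2 where e: "(e1, e2) \<in> E" "e1 \<noteq> e2" using relation_nonempty[OF basic_in_X(1)] by auto
    obtain f1 f2 where ff: "(f1, f2) \<in> F" "(f1, f2) \<notin> E" using relation_nonempty[OF basic_in_X(2)] by auto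
    have "f1 \<noteq> f2" using ff by auto
    obtain \<alpha> \<beta> \<alpha>' \<beta>' where ab: "(\<alpha>, \<beta>) \<in> S" "(\<alpha>', \<beta>') \<in> T" "(\<alpha>, \<alpha>') \<in> E" "(\<beta>, \<beta>') \<in> E"
      using S_not_block_closed .
    have "x = y" using c[OF refl_F E_F[OF e(1)], of e1] e by (simp add: entry)
    moreover have "x = z" using c[OF refl_F ff(1), of f1] ff \<open>f1 \<noteq> f2\<close> by (simp add: entry)
    moreover have "u = w"
    proof -
      have "(\<alpha>', \<beta>') \<notin> S" using S_T_disjoint ab(2) by blast
      moreover have "(p, q) \<notin> E \<and> p \<noteq> q" if "(p, q) \<notin> F" for p q using that E_F by auto
      ultimately show ?thesis
        using c[OF E_F[OF ab(3)] E_F[OF ab(4)]] S_not_F[OF ab(1)] T_not_F[OF ab(2)] ab(1) by (simp add: entry)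
    qed
    moreover have "A_F = mat_scale (of_nat m * of_nat n) (eF + e0)" by (simp add: eF_def)
    moreover have "J = mat_scale (of_nat f * of_nat m * of_nat n) e0" by (simp add: e0_def)
    ultimately have "A = mat_scale (z - w) (mat_scale (of_nat m * of_nat n) (eF + e0))
        + mat_scale w (mat_scale (of_nat f * of_nat m * of_nat n) e0)"
      using lin by (metis add_0_left add_0_right cancel_comm_monoid_add_class.diff_cancel cmat.scale_zero_left)
    then show "A \<in> cmat.span {e0, eF}"
      by (simp only:) (intro cmat.span_add cmat.span_scale cmat.span_base; simp)
  qed
qed

lemma hadamard_subalgebra_blocks: "hadamard_subalgebra X (cmat.span {e0, eF})"
  unfolding hadamard_subalgebra_def
proof (intro conjI ballI)
  show "cmat.span {e0, eF} \<subseteq> adjacency_algebra X" unfolding block_span by auto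
  show "all_ones \<in> cmat.span {e0, eF}"
    unfolding block_span using all_ones_in_algebra by (simp add: constant_on_blocks_iff[OF equiv_F])
  fix A B assume AB: "A \<in> cmat.span {e0, eF}" "B \<in> cmat.span {e0, eF}"
  then have c: "(\<alpha>, \<alpha>') \<in> F \<Longrightarrow> (\<beta>, \<beta>') \<in> F \<Longrightarrow> A $ \<alpha> $ \<beta> = A $ \<alpha>' $ \<beta>' \<and> B $ \<alpha> $ \<beta> = B $ \<alpha>' $ \<beta>'" for \<alpha> \<alpha>' \<beta> \<beta>'
    unfolding block_span constant_on_blocks_iff[OF equiv_F] by blast
  show "hadamard A B \<in> cmat.span {e0, eF}"
    using AB unfolding block_span
    by (auto simp: constant_on_blocks_iff[OF equiv_F] intro!: hadamard_in_algebra arg_cong2[where f = "(*)"] dest: c)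
qed (rule cmat.subspace_span)

text \<open>\<open>eF\<close> separates the diagonal from \<open>T\<close>, so the subalgebra is not
  trivial; the identity matrix separates the diagonal from \<open>F - E\<close>, so it is not
  block-constant and the subalgebra is proper.\<close>

lemma index_sets_blocks:
  assumes "Es 0 = e0" "Es 4 = eF"
  shows "{0, 4} \<in> index_sets X 4 Es"
proof -
  have im: "Es ` {0, 4} = {e0, eF}" using assms by simp
  have "eF \<notin> cmat.span {all_ones}"
  proof (rule notI)
    assume "eF \<in> cmat.span {all_ones}"
    then obtain q where q: "eF = mat_scale q all_ones" by (auto simp: cmat.span_singleton)
    obtain t1 t2 where "(t1, t2) \<in> T" using relation_nonempty[OF basic_in_X(4)] by auto
    then have "(t1, t2) \<notin> F" by (rule T_not_F)
    moreover have "eF $ t1 $ t1 = eF $ t1 $ t2" unfolding q by simp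
    ultimately show False by (simp add: eF_entry)
  qed
  moreover have "mat 1 \<notin> cmat.span {e0, eF}"
  proof
    assume "mat 1 \<in> cmat.span {e0, eF}"
    then have c: "constant_on_blocks F (mat 1 :: complex^'n^'n)" unfolding block_span by blast
    obtain f1 f2 where ff: "(f1, f2) \<in> F" "(f1, f2) \<notin> E" using relation_nonempty[OF basic_in_X(2)] by auto
    have "f1 \<noteq> f2" using ff by auto
    then show False
      using c[unfolded constant_on_blocks_iff[OF equiv_F], rule_format, OF refl_F ff(1), of f1] by (simp add: mat_def)
  qed
  moreover have "eF \<in> cmat.span {e0, eF}" by (rule cmat.span_base) simp
  ultimately have "cmat.span {e0, eF} \<noteq> cmat.span {all_ones}" "cmat.span {e0, eF} \<noteq> adjacency_algebra X"
    using one_in_algebra by metis+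
  then show ?thesis
    unfolding index_sets_def using hadamard_subalgebra_blocks im by simp
qed

text \<open>Closure puts the entrywise square of \<open>M\<close> in the span of \<open>M\<close>
  and a constant matrix, so all entries of \<open>M\<close> are roots of one quadratic and take at
  most two values.\<close>

lemma three_values_not_subalgebra:
  assumes sub: "hadamard_subalgebra X (cmat.span {e0, M})"
    and "M $ \<alpha>1 $ \<beta>1 \<noteq> M $ \<alpha>2 $ \<beta>2" "M $ \<alpha>1 $ \<beta>1 \<noteq> M $ \<alpha>3 $ \<beta>3" "M $ \<alpha>2 $ \<beta>2 \<noteq> M $ \<alpha>3 $ \<beta>3"
  shows False
proof -
  have "hadamard M M \<in> cmat.span {e0, M}"
    using sub unfolding hadamard_subalgebra_def by (blast intro: cmat.span_base)
  then obtain p where "hadamard M M - mat_scale p e0 \<in> cmat.span {M}"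
    unfolding cmat.span_insert by blast
  then obtain q where q: "hadamard M M - mat_scale p e0 = mat_scale q M"
    by (auto simp: cmat.span_singleton)
  define r :: complex where "r = p / (of_nat f * of_nat m * of_nat n)"
  have e: "M $ \<alpha> $ \<beta> * M $ \<alpha> $ \<beta> - r = q * M $ \<alpha> $ \<beta>" for \<alpha> \<beta>
    using arg_cong[OF q, of "\<lambda>A. A $ \<alpha> $ \<beta>"] by (simp add: e0_def r_def)
  have "(x - y) * (x + y - q) = 0" if "x * x - r = q * x" "y * y - r = q * y" for x y :: complex
    using that by algebra
  then have "M $ \<alpha>1 $ \<beta>1 + M $ \<alpha>2 $ \<beta>2 - q = 0" "M $ \<alpha>1 $ \<beta>1 + M $ \<alpha>3 $ \<beta>3 - q = 0"
    using e assms(2,3) by (metis mult_eq_0_iff right_minus_eq)+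
  then have "M $ \<alpha>2 $ \<beta>2 = M $ \<alpha>3 $ \<beta>3" by (metis add_left_cancel right_minus_eq)
  then show False using assms(4) by simp
qed

text \<open>The other candidates have three different entries: the projections of \<open>G\<close>
  on the diagonal, on \<open>E - Id\<close> and on \<open>F - E\<close>, and \<open>eE\<close> on
  the diagonal, on \<open>F - E\<close> and off \<open>F\<close>.\<close>

lemma index_set_idempotent:
  assumes "{0, 4} \<in> index_sets X 4 Es" "Es 0 = e0" "Es 4 \<in> {e0, P \<theta> \<tau>, eE, P \<tau> \<theta>, eF}" "roots \<theta> \<tau>" "Es 4 \<noteq> e0"
  shows "Es 4 = eF"
proof -
  have sub: "hadamard_subalgebra X (cmat.span {e0, Es 4})"
    using assms(1,2) by (simp add: index_sets_def)
  obtain e1 e2 where e: "(e1, e2) \<in> E" "e1 \<noteq> e2" using relation_nonempty[OF basic_in_X(1)] by auto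
  obtain f1 f2 where ff: "(f1, f2) \<in> F" "(f1, f2) \<notin> E" using relation_nonempty[OF basic_in_X(2)] by auto
  have f12: "f1 \<noteq> f2" using ff by auto
  obtain s1 s2 where s: "(s1, s2) \<notin> F" using F_proper by auto
  then have sE: "(s1, s2) \<notin> E" using E_F by blast
  have "Es 4 \<noteq> P \<theta> \<tau>" if r: "roots \<theta> \<tau>" for \<theta> \<tau>
  proof
    assume eq: "Es 4 = P \<theta> \<tau>"
    define p :: complex where "p = of_real (- \<tau> / (\<theta> - \<tau>))"
    have p: "p \<noteq> 0" using roots_nonzero(2)[OF r] r by (simp add: p_def roots_def)
    have "P \<theta> \<tau> $ e1 $ e1 = p * (1 - 1 / of_nat n)" "P \<theta> \<tau> $ e1 $ e2 = p * (- 1 / of_nat n)" "P \<theta> \<tau> $ f1 $ f2 = 0"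
      using e ff f12 E_F[OF e(1)] by (simp_all only: P_entry N_entry p_def if_True if_False refl_F) auto
    moreover have "p * (1 - 1 / of_nat n) - p * (- 1 / of_nat n) = p" by (simp add: algebra_simps)
    then have "p * (1 - 1 / of_nat n) \<noteq> p * (- 1 / of_nat n)" using p by auto
    ultimately show False
      using three_values_not_subalgebra[OF sub[unfolded eq], of e1 e1 e1 e2 f1 f2] p by simp
  qed
  moreover have "Es 4 \<noteq> eE"
  proof
    assume eq: "Es 4 = eE"
    have "eE $ e1 $ e1 = 1 / of_nat n - 1 / (of_nat m * of_nat n)" "eE $ f1 $ f2 = - 1 / (of_nat m * of_nat n)" "eE $ s1 $ s2 = 0"
      using ff s sE by (simp_all add: eE_entry)
    then show False
      using three_values_not_subalgebra[OF sub[unfolded eq], of e1 e1 f1 f2 s1 s2] by simp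
  qed
  ultimately show ?thesis using assms(3-5) roots_commute by blast
qed

text \<open>\<open>A_F\<close> is mn times the sum of \<open>e0\<close> and \<open>eF\<close>, and
  both summands absorb it up to the factor mn. Hence \<open>A_F\<close> kills the entrywise product
  exactly if both idempotents do, that is, if the Krein parameters at 0 and 4 vanish.\<close>

lemma index_relation_iff:
  assumes orth: "orthogonal_idempotents Es 4" and span: "adjacency_algebra X = cmat.span (Es ` {..4})"
    and Es: "Es 0 = e0" "Es 4 = eF"
  shows "(i, j) \<in> index_relation 4 Es {0, 4} \<longleftrightarrow> i \<le> 4 \<and> j \<le> 4 \<and> linked (Es i) (Es j)"
proof (cases "i \<le> 4 \<and> j \<le> 4")
  case True
  let ?H = "hadamard (Es i) (Es j)"
  have "Es i \<in> adjacency_algebra X" "Es j \<in> adjacency_algebra X"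
    unfolding span using True by (auto intro: cmat.span_base)
  then have H: "?H \<in> cmat.span (Es ` {..4})"
    unfolding span[symmetric] by (rule hadamard_in_algebra)
  have krein: "krein 4 Es i j k \<noteq> 0 \<longleftrightarrow> Es k ** ?H \<noteq> 0" if "k \<le> 4" for k
    using orthogonal_idempotents.krein_nonzero_iff[OF orth H that] .
  have AF: "A_F = mat_scale (of_nat m * of_nat n) (eF + e0)" by (simp add: eF_def)
  have "e0 ** A_F = mat_scale (of_nat m * of_nat n) e0" "eF ** A_F = mat_scale (of_nat m * of_nat n) eF"
    using commute_algebra[OF AF_in e0_in] commute_algebra[OF AF_in eF_in] AF_e0 AF_eF by simp_all
  then have absorb: "e0 ** (A_F ** ?H) = mat_scale (of_nat m * of_nat n) (e0 ** ?H)"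
      "eF ** (A_F ** ?H) = mat_scale (of_nat m * of_nat n) (eF ** ?H)"
    by (simp_all add: matrix_mul_assoc)
  have "(e0 ** ?H \<noteq> 0 \<or> eF ** ?H \<noteq> 0) \<longleftrightarrow> A_F ** ?H \<noteq> 0"
  proof
    assume "e0 ** ?H \<noteq> 0 \<or> eF ** ?H \<noteq> 0"
    then show "A_F ** ?H \<noteq> 0" using absorb by auto
  next
    assume "A_F ** ?H \<noteq> 0"
    then show "e0 ** ?H \<noteq> 0 \<or> eF ** ?H \<noteq> 0"
      by (subst (asm) AF) (auto simp: matrix_mult_add_right)
  qed
  then show ?thesis
    using True krein[of 0] krein[of 4] Es by (simp add: index_relation_def linked_def)
next
  case False
  then show ?thesis by (auto simp: index_relation_def)
qed

lemma index_parabolic_blocks: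
  assumes "Es 0 = e0" "Es 4 = eF"
  shows "card (UNIV // index_parabolic X Es {0, 4}) = f"
proof -
  have "index_parabolic X Es {0, 4} = F"
    using assms block_span by (intro index_parabolic_eq[OF parabolic_F]) simp
  then show ?thesis by (simp add: card_quotient_F)
qed

section \<open>The two directions of the Q-Higmanian criterion\<close>

lemma e0_eq: "e0 = mat_scale (1 / of_nat CARD('n)) all_ones"
  by (simp add: e0_def card_points)

text \<open>The order \<open>std\<close> is used with d = 4 and l = 2. The rank condition at 0 is
  the rank f - 1 of \<open>eF\<close>, the one at 1 is the assumed ratio of the roots.\<close>

lemma Q_higmanianI:
  assumes r: "roots \<theta> \<tau>" and eq: "\<theta> = - (real f - 1) * \<tau>"
  shows "Q_higmanian X"
proof -
  let ?Es = "std \<theta> \<tau>"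
  note orth = std_orthogonal[OF r] and span = std_span[OF r]
  have Es: "?Es 0 = e0" "?Es 4 = eF" by (simp_all add: std_simps)
  have ordering: "idempotent_ordering X 4 ?Es"
    unfolding idempotent_ordering_def bij_betw_def
    using card_X orthogonal_idempotents.inj_on_Es[OF orth]
      orthogonal_idempotents.primitive_idempotents_eq[OF orth span] Es e0_eq by simp
  have link: "linked (?Es i) (?Es j) \<longleftrightarrow> i = j \<or> i + j = 4" if "i \<le> 4" "j \<le> 4" for i j :: nat
  proof -
    have ij: "i \<in> {0, 1, 2, 3, 4}" "j \<in> {0, 1, 2, 3, 4}" using that by auto
    note L = linked_idempotents[OF r] linked_idempotents[OF roots_commute[OF r]]
    have L': "linked eF e0" "\<not> linked eE e0" "\<not> linked (P \<theta> \<tau>) e0" "\<not> linked (P \<tau> \<theta>) e0" "\<not> linked eE eF"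
      "\<not> linked (P \<theta> \<tau>) eF" "\<not> linked (P \<tau> \<theta>) eF" "\<not> linked (P \<theta> \<tau>) eE" "\<not> linked (P \<tau> \<theta>) eE"
      using L linked_commute by blast+
    show ?thesis
      using ij by (elim insertE emptyE; simp add: std_simps[simplified] L L')
  qed
  have rel: "index_relation 4 ?Es {0, 4} = {(i, j). i \<le> 4 \<and> j \<le> 4 \<and> (i = j \<or> i + j = 4)}"
    using index_relation_iff[OF orth span Es] link by auto
  have "index_relation 4 ?Es {0, 4} `` {0} = {0, 4}" "index_relation 4 ?Es {0, 4} `` {1} = {1, 3}"
    "index_relation 4 ?Es {0, 4} `` {2} = {2}" "index_relation 4 ?Es {0, 4} `` {3} = {1, 3}"
    "index_relation 4 ?Es {0, 4} `` {4} = {0, 4}"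
    unfolding rel by auto
  then have "{..4} // index_relation 4 ?Es {0, 4} = {{0, 4}, {1, 3}, {2}}"
    unfolding quotient_def atMost_4 by auto
  moreover have "{{i, 4 - i} | i. i < 2} \<union> {{i} | i. 2 \<le> i \<and> i \<le> 4 - 2} = {{0, 4}, {1, 3}, {2 :: nat}}"
    by (auto simp: less_2_cases_iff)
  ultimately have quot: "{..4} // index_relation 4 ?Es {0, 4} =
      {{i, 4 - i} | i. i < 2} \<union> {{i} | i. 2 \<le> i \<and> i \<le> 4 - 2}" by simp
  have "int (rank (?Es (4 - i))) = (int f - 1) * int (rank (?Es i))" if "i < 2" for i
  proof -
    from that consider "i = 0" | "i = 1" by linarith
    then show ?thesis
    proof cases
      case 1
      then show ?thesis using f_ge by (simp add: Es rank_e0 rank_eF of_nat_diff)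
    next
      case 2
      then show ?thesis using rank_ratio[OF r] eq by (simp add: std_simps[simplified])
    qed
  qed
  then have ranks: "\<forall>i<2. int (rank (?Es (4 - i))) =
      (int (card (UNIV // index_parabolic X ?Es {0, 4})) - 1) * int (rank (?Es i))"
    by (simp add: index_parabolic_blocks[OF Es])
  show ?thesis
    unfolding Q_higmanian_def using commutative
    by (intro conjI exI[of _ 4] exI[of _ ?Es] exI[of _ 2])
      (use ordering index_sets_blocks[of ?Es, OF Es] quot ranks in simp_all)
qed

text \<open>Five basic relations give d = 4, and the index set {0, 4} forces \<open>eF\<close> into
  the last place. The two projections of \<open>G\<close> are linked, so they occupy the pair {1,
  3}; this makes l = 2 and yields the rank condition at 1.\<close>

lemma Q_higmanianD:
  assumes Q: "Q_higmanian X" and r: "roots \<theta> \<tau>"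
  shows "\<theta> = - (real f - 1) * \<tau> \<or> \<tau> = - (real f - 1) * \<theta>"
proof -
  obtain d Es l where ordering: "idempotent_ordering X d Es" and l: "1 \<le> l" "2 * l \<le> d"
    and I: "{0, d} \<in> index_sets X d Es"
    and quot: "{..d} // index_relation d Es {0, d} = {{i, d - i} | i. i < l} \<union> {{i} | i. l \<le> i \<and> i \<le> d - l}"
    and ranks: "\<forall>i<l. int (rank (Es (d - i))) =
      (int (card (UNIV // index_parabolic X Es {0, d})) - 1) * int (rank (Es i))"
    using Q unfolding Q_higmanian_def by (elim conjE exE) (rule that; assumption)
  have d: "d = 4" using ordering card_X by (simp add: idempotent_ordering_def)
  note facts = I[unfolded d] quot[unfolded d] ranks[unfolded d]
  have bij: "bij_betw Es {..4} {e0, P \<theta> \<tau>, eE, P \<tau> \<theta>, eF}" and Es0: "Es 0 = e0"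
    using ordering unfolding idempotent_ordering_def d primitive_idempotents[OF r] e0_eq by auto
  have inj: "Es i = Es j \<longleftrightarrow> i = j" if "i \<le> 4" "j \<le> 4" for i j
    using bij that by (auto simp: bij_betw_def inj_on_def)
  have in_set: "Es i \<in> {e0, P \<theta> \<tau>, eE, P \<tau> \<theta>, eF}" if "i \<le> 4" for i
    using bij_betwE[OF bij] that by auto
  have Es4: "Es 4 = eF"
    using index_set_idempotent[OF facts(1) Es0 in_set r] inj[of 4 0] Es0 by simp
  interpret std: orthogonal_idempotents "std \<theta> \<tau>" 4 by (rule std_orthogonal[OF r])
  \<comment> \<open>\<open>Es\<close> is a rearrangement of \<open>std\<close>, so orthogonality
    carries over.\<close>
  have orth: "orthogonal_idempotents Es 4"
  proof
    fix i :: nat assume i: "i \<le> 4"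
    then obtain i' where i': "i' \<le> 4" "Es i = std \<theta> \<tau> i'"
      using in_set[OF i] unfolding std_image[symmetric] by auto
    then show "Es i \<noteq> 0" using std.nonzero by simp
    fix j :: nat assume j: "j \<le> 4"
    then obtain j' where j': "j' \<le> 4" "Es j = std \<theta> \<tau> j'"
      using in_set[OF j] unfolding std_image[symmetric] by auto
    have "i = j \<longleftrightarrow> i' = j'"
      using inj[OF i j] i' j' std.inj_on_Es by (auto simp: inj_on_def)
    then show "Es i ** Es j = (if i = j then Es i else 0)"
      using std.mult[OF i'(1) j'(1)] i' j' by simp
  qed
  have span: "adjacency_algebra X = cmat.span (Es ` {..4})"
    using std_span[OF r] bij unfolding std_image bij_betw_def by simp
  note rel = index_relation_iff[OF orth span Es0 Es4]
  have "P \<theta> \<tau> \<in> Es ` {..4}" "P \<tau> \<theta> \<in> Es ` {..4}"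
    unfolding bij_betw_imp_surj_on[OF bij] by simp_all
  then obtain i j where i: "i \<le> 4" "Es i = P \<theta> \<tau>" and j: "j \<le> 4" "Es j = P \<tau> \<theta>"
    by (elim imageE) simp
  have neq: "std \<theta> \<tau> p \<noteq> std \<theta> \<tau> q" if "p \<le> 4" "q \<le> 4" "p \<noteq> q" for p q
    using std.inj_on_Es that by (auto simp: inj_on_def)
  have distinct: "P \<theta> \<tau> \<noteq> P \<tau> \<theta>" "P \<theta> \<tau> \<noteq> e0" "P \<tau> \<theta> \<noteq> e0" "P \<theta> \<tau> \<noteq> eF" "P \<tau> \<theta> \<noteq> eF"
    using neq[of 1 3] neq[of 1 0] neq[of 3 0] neq[of 1 4] neq[of 3 4] by (simp_all add: std_simps[simplified])
  have ij: "i \<noteq> j" "i \<noteq> 0" "j \<noteq> 0" "i \<noteq> 4" "j \<noteq> 4"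
    using i j distinct Es0 Es4 by metis+
  define C where "C = index_relation 4 Es {0, 4} `` {i}"
  have C_mem: "i \<in> C" "j \<in> C"
    using rel i j linked_idempotents(4,6)[OF r] by (auto simp: C_def)
  have "C \<in> {..4} // index_relation 4 Es {0, 4}" unfolding C_def using i(1) by (intro quotientI) simp
  then have "C \<in> {{i, 4 - i} | i. i < l} \<union> {{i} | i. l \<le> i \<and> i \<le> 4 - l}"
    unfolding facts(2) .
  then obtain i' where i': "i' < l" "C = {i', 4 - i'}"
    using C_mem ij(1) by auto
  \<comment> \<open>The pair {0, 4} is taken by \<open>e0\<close> and \<open>eF\<close>, so the pair
    of the two projections has index 1, which lies below \<open>l\<close>.\<close>
  have "l \<le> 2" using l d by simp
  then have "i' = 1"
    using C_mem i' ij by (cases i') auto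
  then have "1 < l" "i = 1 \<and> j = 3 \<or> i = 3 \<and> j = 1"
    using i' C_mem ij by auto
  then have "int (rank (Es 3)) = (int f - 1) * int (rank (Es 1))"
    using facts(3)[rule_format, of 1] index_parabolic_blocks[of Es, OF Es0 Es4] by simp
  \<comment> \<open>Either projection may stand at place 1; each possibility gives one of the two
    alternatives.\<close>
  then show ?thesis
    using \<open>i = 1 \<and> j = 3 \<or> i = 3 \<and> j = 1\<close> i(2) j(2) rank_ratio[OF r] rank_ratio[OF roots_commute[OF r]] by auto
qed

section \<open>From the ratio of the roots to the formula for t\<close>

definition w :: real where "w = sqrt (real k * (real m * real n - real k) / (real m * (real n - 1)))"

lemma a_eq: "a = (real f - 1) * w\<^sup>2"
proof -
  have "real k < real m * real n" using k_less by (metis of_nat_less_iff of_nat_mult)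
  then have "0 \<le> real k * (real m * real n - real k) / (real m * (real n - 1))"
    using n_ge by simp
  then have "w\<^sup>2 = real k * (real m * real n - real k) / (real m * (real n - 1))"
    by (simp add: w_def)
  then show ?thesis by (simp add: a_def)
qed

text \<open>The product of the roots gives \<tau>^2 = w^2 and their sum gives b = -(f - 2) \<tau>;
  the sign \<epsilon> is the one with \<tau> = -\<epsilon> w.\<close>

lemma root_ratio_imp:
  assumes r: "roots \<theta> \<tau>" and eq: "\<theta> = - (real f - 1) * \<tau>"
  shows "\<exists>\<epsilon>\<in>{1, -1}. b = \<epsilon> * (real f - 2) * w"
proof -
  have "(real f - 1) * \<tau>\<^sup>2 = (real f - 1) * w\<^sup>2"
    using r eq a_eq by (simp add: roots_def power2_eq_square algebra_simps)
  then have "\<tau>\<^sup>2 = w\<^sup>2" using f_ge by simp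
  then have "\<tau> = w \<or> \<tau> = - w" by (simp add: power2_eq_iff)
  moreover have "b = - (real f - 2) * \<tau>" using r eq by (simp add: roots_def algebra_simps)
  ultimately have "b = (- 1) * (real f - 2) * w \<or> b = 1 * (real f - 2) * w" by (auto simp: algebra_simps)
  then show ?thesis by blast
qed

text \<open>For this \<open>b\<close> the quadratic x^2 - b x - a factors as (x - \<epsilon> (f - 1)
  w)(x + \<epsilon> w), so the two roots are these zeros in one order or the other.\<close>

lemma root_ratio_if:
  assumes r: "roots \<theta> \<tau>" and b: "b = \<epsilon> * (real f - 2) * w" and \<epsilon>: "\<epsilon> \<in> {1, -1}"
  shows "\<theta> = - (real f - 1) * \<tau> \<or> \<tau> = - (real f - 1) * \<theta>"
proof -
  have e2: "\<epsilon> * \<epsilon> = 1" using \<epsilon> by auto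
  have sum: "\<theta> + \<tau> = \<epsilon> * (real f - 2) * w" and prod: "\<theta> * \<tau> = - ((real f - 1) * (w * w))"
    using r b a_eq by (simp_all add: roots_def power2_eq_square)
  have "(\<theta> - \<epsilon> * (real f - 1) * w) * (\<theta> + \<epsilon> * w) = 0"
    using e2 sum prod by algebra
  then consider "\<theta> = \<epsilon> * (real f - 1) * w" | "\<theta> = - \<epsilon> * w" by (auto simp: add_eq_0_iff)
  then show ?thesis
  proof cases
    case 1
    then have "\<tau> = - \<epsilon> * w" using sum by (simp add: algebra_simps)
    then show ?thesis using 1 by (simp add: algebra_simps)
  next
    case 2
    then have "\<tau> = \<epsilon> * (real f - 1) * w" using sum by (simp add: algebra_simps)
    then show ?thesis using 2 by (simp add: algebra_simps)
  qed
qed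

text \<open>Solving the definition of \<open>b\<close> for t gives t = q ((f - 2)(mn - k) + b) with
  q = k/(mn) nonzero.\<close>

lemma t_formula_iff:
  "real t = real k * (real f - 2) / (real m * real n) * (real m * real n - real k + \<epsilon> * w) \<longleftrightarrow>
    b = \<epsilon> * (real f - 2) * w"
proof -
  define q where "q = real k / (real m * real n)"
  have q: "q \<noteq> 0" by (simp add: q_def)
  have "real t = q * ((real f - 2) * (real m * real n - real k) + b)"
    by (simp add: b_def q_def)
  moreover have "real k * (real f - 2) / (real m * real n) * (real m * real n - real k + \<epsilon> * w) =
      q * ((real f - 2) * (real m * real n - real k) + \<epsilon> * (real f - 2) * w)"
    by (simp add: q_def algebra_simps add_divide_distrib diff_divide_distrib)
  ultimately show ?thesis using q by simp
qed

lemma Q_higmanian_iff: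
  "Q_higmanian X \<longleftrightarrow> (\<exists>\<epsilon>\<in>{1, -1 :: real}.
     real t = real k * (real f - 2) / (real m * real n) * (real m * real n - real k + \<epsilon> * w))"
proof -
  obtain \<theta> \<tau> where r: "roots \<theta> \<tau>" using ex_roots by blast
  have "Q_higmanian X \<longleftrightarrow> \<theta> = - (real f - 1) * \<tau> \<or> \<tau> = - (real f - 1) * \<theta>"
    using Q_higmanianD[OF _ r] Q_higmanianI[OF r] Q_higmanianI[OF roots_commute[OF r]] by blast
  also have "\<dots> \<longleftrightarrow> (\<exists>\<epsilon>\<in>{1, -1}. b = \<epsilon> * (real f - 2) * w)"
    using root_ratio_imp[OF r] root_ratio_imp[OF roots_commute[OF r]] root_ratio_if[OF r] by blast
  finally show ?thesis by (simp only: t_formula_iff)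
qed

end

text \<open>Two of the five basic relations lie outside \<open>F\<close>, so three lie inside.
  \<open>E\<close> contains \<open>Id\<close> and at least one more, but not all three; hence it
  contains exactly one more, and the third fills \<open>F - E\<close>.\<close>

lemma (in scheme) nested_parabolics_relations:
  assumes E: "parabolic UNIV X E" and F: "parabolic UNIV X F" and sub: "E \<subset> F" and nontrivial: "E \<noteq> Id"
    and card_X: "card X = 5" and outside: "{R \<in> X. \<not> R \<subseteq> F} = {S, T}" and neq: "S \<noteq> T"
  shows "X = {Id, E - Id, F - E, S, T}"
proof -
  define XE where "XE = {R \<in> X. R \<subseteq> E}"
  define XF where "XF = {R \<in> X. R \<subseteq> F}"
  have fin: "finite X" using card_X by (metis card.infinite zero_neq_numeral)
  have UE: "\<Union>XE = E" and UF: "\<Union>XF = F"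
    using parabolic_Union_eq[OF E] parabolic_Union_eq[OF F] by (simp_all add: XE_def XF_def)
  have X_split: "X = XF \<union> {S, T}" "XF \<inter> {S, T} = {}"
    using outside by (auto simp: XF_def)
  have "finite XF" using fin X_split by (metis finite_Un)
  then have card_XF: "card XF = 3"
    using card_X neq X_split by (auto simp: card_Un_disjoint)
  have Id_E: "Id \<subseteq> E" using E by (auto simp: parabolic_def equiv_def refl_on_def)
  then have Id_XE: "Id \<in> XE" using Id_in by (simp add: XE_def)
  have "XE \<noteq> {Id}" using UE nontrivial by auto
  then obtain R1 where R1: "R1 \<in> XE" "R1 \<noteq> Id" using Id_XE by blast
  have "XE \<subseteq> XF" using sub by (auto simp: XE_def XF_def)
  moreover have "XE \<noteq> XF" using UE UF sub by auto
  ultimately have "XE \<subset> XF" by (rule psubsetI)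
  then obtain R2 where R2: "R2 \<in> XF" "R2 \<notin> XE" by (meson psubset_imp_ex_mem DiffD1 DiffD2)
  have "{Id, R1, R2} \<subseteq> XF" using Id_XE R1 R2 \<open>XE \<subseteq> XF\<close> by blast
  moreover have "card {Id, R1, R2} = 3" using R1 R2 Id_XE by (auto simp: card_insert_if)
  ultimately have XF: "XF = {Id, R1, R2}"
    using \<open>finite XF\<close> card_XF card_subset_eq by metis
  have XE: "XE = {Id, R1}" using XF R2 R1 Id_XE \<open>XE \<subseteq> XF\<close> by blast
  have "R1 \<inter> Id = {}" using disjoint_X[of R1 Id] R1 Id_in by (auto simp: XE_def)
  then have "E - Id = R1" using UE XE by auto
  moreover have "R2 \<inter> E = {}"
    using parabolic_relation_cases[OF E, of R2] R2 by (auto simp: XE_def XF_def)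
  then have "F - E = R2" using UF UE XF XE by auto
  ultimately show ?thesis using X_split(1) XF by auto
qed

lemma Id_on_UNIV: "Id_on UNIV = Id"
  by auto

theorem theorem2:
  fixes X :: "('a::finite \<times> 'a) set set" and f m n k t :: nat
  assumes "higmanian UNIV X"
    and "higmanian_parameters UNIV X f m n k t"
    and "f \<ge> 2" and "m \<ge> 2" and "n \<ge> 2"
  shows "Q_higmanian X \<longleftrightarrow>
    (\<exists>\<epsilon>\<in>{1, -1 :: real}.
       real t = real k * (real f - 2) / (real m * real n) *
         (real m * real n - real k +
          \<epsilon> * sqrt (real k * (real m * real n - real k) / (real m * (real n - 1)))))"
proof -
  have hig: "symmetric_scheme UNIV X" "\<not> decomposable UNIV X" "card X = 5"
    using assms(1) by (auto simp: higmanian_def)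
  obtain E F S T where sub: "E \<subset> F" and par: "{P. proper_nontrivial_parabolic UNIV X P} = {E, F}"
    and ST: "S \<noteq> T" "{R \<in> X. \<not> R \<subseteq> F} = {S, T}"
    and f: "real f = real CARD('a) / real (valency UNIV F)"
    and m: "real m = real (valency UNIV F) / real (valency UNIV E)"
    and n: "n = valency UNIV E"
    and k: "k = (THE k. \<forall>\<alpha>\<in>UNIV. \<forall>\<Delta>\<in>UNIV // F. \<alpha> \<notin> \<Delta> \<longrightarrow> card {\<beta>\<in>\<Delta>. (\<alpha>, \<beta>) \<in> S} = k)"
    and t: "t = intersection_number T S T"
    using assms(2) unfolding higmanian_parameters_def by (elim exE conjE) (rule that; assumption)
  interpret sym_scheme X by unfold_locales (rule hig(1))
  have "proper_nontrivial_parabolic UNIV X E" "proper_nontrivial_parabolic UNIV X F"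
    using par by blast+
  then have EF: "parabolic UNIV X E" "parabolic UNIV X F" "E \<noteq> Id" "F \<noteq> UNIV"
    unfolding proper_nontrivial_parabolic_def Id_on_UNIV by simp_all
  have X_eq: "X = {Id, E - Id, F - E, S, T}"
    by (rule nested_parabolics_relations[OF EF(1,2) sub EF(3) hig(3) ST(2,1)])
  \<comment> \<open>The parameters f and m are given as real quotients; the bound on n makes the
    valency of \<open>E\<close> nonzero, so that the quotient for m can be cleared.\<close>
  have "valency UNIV E \<noteq> 0" using n assms(5) by simp
  then have vF: "valency UNIV F = m * n"
    using m n by (simp add: field_simps flip: of_nat_mult)
  have card: "CARD('a) = f * m * n"
    using f vF assms(4,5) by (simp add: field_simps flip: of_nat_mult)
  \<comment> \<open>\<open>F\<close> is a union of basic relations, so a basic relation not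
    contained in it is disjoint from it.\<close>
  have outside: "S \<union> T = - F"
  proof -
    have "S \<in> {R \<in> X. \<not> R \<subseteq> F}" "T \<in> {R \<in> X. \<not> R \<subseteq> F}"
      unfolding ST(2) by simp_all
    then have disjoint: "S \<inter> F = {}" "T \<inter> F = {}"
      using parabolic_relation_cases[OF EF(2), of S] parabolic_relation_cases[OF EF(2), of T] by simp_all
    have "UNIV = \<Union>{R \<in> X. R \<subseteq> F} \<union> \<Union>{R \<in> X. \<not> R \<subseteq> F}"
      unfolding union_X[symmetric] by blast
    also have "\<dots> = F \<union> (S \<union> T)"
      unfolding parabolic_Union_eq[OF EF(2)] ST(2) by simp
    finally show ?thesis using disjoint by blast
  qed
  interpret higman X E F S T f m n k t
  proof
    show "card (E `` {\<alpha>}) = n" for \<alpha> using card_class_constant[OF EF(1)] n by simp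
    show "card (F `` {\<alpha>}) = m * n" for \<alpha> using card_class_constant[OF EF(2)] vF by simp
  qed (use EF sub X_eq outside ST hig card assms(3-5) k t in auto)
  show ?thesis
    using Q_higmanian_iff by (simp only: w_def)
qed

end
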